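(* Let $\beta$ be hyperbolic. Then there exists a real number $\lambda>1$ such that for every $x\in X(\beta)$ the limit $$\mu(x):=\lim_{n\to\infty}\frac{1}{\lambda^n}\mathcal N_n(x)$$ exists and satisfies $\mu(x)\in(0,\infty)$. Furthermore, the measure $\mu$ on $X(\beta)$ giving mass $\mu(x)$ to each point $x\in X(\beta)$ has infinite total mass, i.e. $\sum_{x\in X(\beta)}\mu(x)=\infty$.
   Context: A real number $\beta>1$ is called hyperbolic if it is an algebraic integer, is a root of a nonzero polynomial with coefficients in $\{-1,0,1\}$, and has no Galois conjugate of absolute value one. $X(\beta):=\left\{\sum_{i=1}^n c_i\beta^{n-i}: n\in\mathbb N,\ c_i\in\{-1,0,1\}\right\}$. For $x\in\mathbb R$ and $n\in\mathbb N$, $$\mathcal N_n(x)=\#\left\{(a_1,\dots,a_n,b_1,\dots,b_n)\in\{0,1\}^{2n}:\ \sum_{i=1}^n (a_i-b_i)\beta^{n-i}=x\right\}.$$ *)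

theory Defs
  imports "HOL-Analysis.Analysis" "HOL-Computational_Algebra.Computational_Algebra"
begin

definition minimal_polynomial :: "rat poly \<Rightarrow> real \<Rightarrow> bool" where
  "minimal_polynomial p \<beta> \<longleftrightarrow>
     lead_coeff p = 1 \<and> irreducible p \<and> poly (map_poly of_rat p) \<beta> = 0"

text \<open>A number counts as its own conjugate here; this is harmless in the definition of
  hyperbolicity, where \<open>\<beta> > 1\<close>.\<close>

definition galois_conjugate :: "real \<Rightarrow> complex \<Rightarrow> bool" where
  "galois_conjugate \<beta> z \<longleftrightarrow>
     (\<exists>p. minimal_polynomial p \<beta> \<and> poly (map_poly of_rat p) z = 0)"

definition hyperbolic :: "real \<Rightarrow> bool" where
  "hyperbolic \<beta> \<longleftrightarrow>
     \<beta> > 1 \<and>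
     algebraic_int \<beta> \<and>
     (\<exists>p :: int poly. p \<noteq> 0 \<and> set (coeffs p) \<subseteq> {-1, 0, 1} \<and> poly (map_poly of_int p) \<beta> = 0) \<and>
     (\<forall>z. galois_conjugate \<beta> z \<longrightarrow> cmod z \<noteq> 1)"

definition X :: "real \<Rightarrow> real set" where
  "X \<beta> = {\<Sum>i=1..n. of_int (c i) * \<beta> ^ (n - i) | (n :: nat) (c :: nat \<Rightarrow> int).
            \<forall>i\<in>{1..n}. c i \<in> {-1, 0, 1}}"

text \<open>Words of length \<open>n\<close> over \<open>{0, 1}\<close> are extensional functions on \<open>{1..n}\<close>, so that
  distinct words are distinct functions and the cardinality below counts words.\<close>

definition N :: "real \<Rightarrow> nat \<Rightarrow> real \<Rightarrow> nat" where
  "N \<beta> n x = card {(a, b).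
     a \<in> {1..n} \<rightarrow>\<^sub>E {0, 1 :: int} \<and> b \<in> {1..n} \<rightarrow>\<^sub>E {0, 1 :: int} \<and>
     (\<Sum>i=1..n. of_int (a i - b i) * \<beta> ^ (n - i)) = x}"

end

theory Submission
  imports Defs
begin

text \<open>
  The number \<open>N \<beta> n x\<close> counts, with weights, the \<open>n\<close>-step paths from \<open>0\<close> to \<open>x\<close> whose steps are
  \<open>x \<mapsto> \<beta> * x + e\<close> with \<open>e\<close> in \<open>{-1, 0, 1}\<close>, the step \<open>e = 0\<close> having weight \<open>2\<close> and the others
  weight \<open>1\<close>. Two facts about these paths control everything.

  First, \<open>N \<beta> n x\<close> is an autocorrelation, so \<open>N \<beta> n x \<le> N \<beta> n 0\<close> (\<open>N_le_N_0\<close>). Secondly, hyperbolicity makes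
  the set of points on closed paths from \<open>0\<close> to \<open>0\<close> finite (\<open>hyperbolic_finite_recurrent\<close>): all conjugates of
  such a point are bounded, those at expanding places because the path has to come back to \<open>0\<close> and those at
  contracting places automatically. Together the two facts give
  \<open>N \<beta> m 0 * N \<beta> n 0 \<le> N \<beta> (m + n) 0 \<le> K * N \<beta> m 0 * N \<beta> n 0\<close>, hence a rate \<open>\<Lambda>\<close> such that
  \<open>N \<beta> n 0 / \<Lambda> ^ n\<close> stays between two positive constants (\<open>geometric_growth_rate\<close>). One has \<open>\<Lambda> \<ge> 2\<close> because
  of the loop of weight \<open>2\<close> at \<open>0\<close>.

  Decomposing closed paths at their first return to \<open>0\<close> turns \<open>N \<beta> n 0 / \<Lambda> ^ n\<close> into a renewal sequence,
  which is aperiodic because of that loop. By the renewal theorem (\<open>renewal_theorem\<close>) it converges to a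
  positive limit. A path to an arbitrary \<open>x\<close> is decomposed at its last visit to \<open>0\<close>
  (\<open>last_visit_decomposition\<close>), which exhibits \<open>N \<beta> n x / \<Lambda> ^ n\<close> as a convolution of the sequence just treated
  with the counts of paths avoiding \<open>0\<close>. The bound \<open>N \<beta> n x \<le> N \<beta> n 0\<close> forces the latter, scaled by
  powers of \<open>\<Lambda>\<close>, to be summable, and dominated convergence yields the limit \<open>\<mu> x\<close>. It is positive on \<open>X \<beta>\<close>
  since \<open>x\<close> can be reached from \<open>0\<close>.

  Finally, \<open>\<mu>\<close> is an eigenfunction with eigenvalue \<open>\<Lambda>\<close> of the operator that describes one step, and it
  is maximal at \<open>0\<close>. If its total mass were finite, then \<open>\<Lambda> = 4\<close>, the total weight of the steps; by
  the maximum principle \<open>\<mu>\<close> would then take its maximal value at infinitely many points, a contradiction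
  (\<open>eigenfunction_infinite_mass\<close>).
\<close>

section \<open>Counting pairs of words\<close>

text \<open>Writing \<open>P y\<close> for the number of \<open>a \<in> A\<close> with \<open>f a = y\<close>, the left-hand side is the autocorrelation
\<open>\<Sum>y. P y * P (y - x)\<close>, which is at most \<open>\<Sum>y. P y ^ 2\<close> because
\<open>2 * P y * P (y - x) \<le> P y ^ 2 + P (y - x) ^ 2\<close>.\<close>

lemma card_shifted_pairs_le:
  fixes f :: "'a \<Rightarrow> 'b::ab_group_add"
  assumes "finite A"
  shows "card {(a, b). a \<in> A \<and> b \<in> A \<and> f a - f b = x} \<le> card {(a, b). a \<in> A \<and> b \<in> A \<and> f a - f b = 0}"
proof -
  define P where "P y = real (card {a \<in> A. f a = y})" for y
  \<comment> \<open>Large enough that both \<open>P y ^ 2\<close> and the shifted \<open>P (y - x) ^ 2\<close> vanish outside of it.\<close>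
  define Y where "Y = f ` A \<union> (\<lambda>y. x + y) ` f ` A"
  have "finite Y" using assms by (simp add: Y_def)
  have pairs: "real (card {(a, b). a \<in> A \<and> b \<in> A \<and> f a - f b = t}) = (\<Sum>y\<in>f ` A. P y * P (y - t))" for t
  proof -
    have "{(a, b). a \<in> A \<and> b \<in> A \<and> f a - f b = t}
        = (SIGMA a:A. {b \<in> A. f b = f a - t})"
      by (auto simp: algebra_simps)
    hence "real (card {(a, b). a \<in> A \<and> b \<in> A \<and> f a - f b = t}) = (\<Sum>a\<in>A. P (f a - t))"
      using assms by (simp add: P_def)
    also have "\<dots> = (\<Sum>y\<in>f ` A. \<Sum>a\<in>{a \<in> A. f a = y}. P (f a - t))"
      by (rule sum.image_gen[OF assms])
    also have "\<dots> = (\<Sum>y\<in>f ` A. P y * P (y - t))"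
      by (intro sum.cong refl) (simp add: P_def)
    finally show ?thesis .
  qed
  have P0: "P y = 0" if "y \<notin> f ` A" for y
  proof -
    have "{a \<in> A. f a = y} = {}" using that by auto
    thus ?thesis by (simp only: P_def) simp
  qed
  have "real (card {(a, b). a \<in> A \<and> b \<in> A \<and> f a - f b = x}) = (\<Sum>y\<in>Y. P y * P (y - x))"
    unfolding pairs using \<open>finite Y\<close> P0 by (intro sum.mono_neutral_left) (auto simp: Y_def)
  also have "\<dots> \<le> (\<Sum>y\<in>Y. (P y ^ 2 + P (y - x) ^ 2) / 2)"
  proof (rule sum_mono)
    fix y
    have "0 \<le> (P y - P (y - x)) ^ 2" by simp
    thus "P y * P (y - x) \<le> (P y ^ 2 + P (y - x) ^ 2) / 2"
      by (simp add: power2_eq_square algebra_simps)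
  qed
  also have "\<dots> = ((\<Sum>y\<in>Y. P y ^ 2) + (\<Sum>y\<in>Y. P (y - x) ^ 2)) / 2"
    by (simp add: sum.distrib add_divide_distrib sum_divide_distrib)
  also have "(\<Sum>y\<in>Y. P y ^ 2) = (\<Sum>y\<in>f ` A. P y ^ 2)"
    using \<open>finite Y\<close> P0 by (intro sum.mono_neutral_right) (auto simp: Y_def)
  also have "(\<Sum>y\<in>Y. P (y - x) ^ 2) = (\<Sum>y\<in>(\<lambda>y. x + y) ` f ` A. P (y - x) ^ 2)"
  proof (rule sum.mono_neutral_right)
    show "\<forall>y\<in>Y - (\<lambda>y. x + y) ` f ` A. P (y - x) ^ 2 = 0"
    proof
      fix y assume y: "y \<in> Y - (\<lambda>y. x + y) ` f ` A"
      have "y - x \<notin> f ` A"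
      proof
        assume "y - x \<in> f ` A"
        hence "x + (y - x) \<in> (\<lambda>y. x + y) ` f ` A" by (rule imageI)
        thus False using y by simp
      qed
      thus "P (y - x) ^ 2 = 0" using P0 by simp
    qed
  qed (use \<open>finite Y\<close> in \<open>auto simp: Y_def\<close>)
  also have "\<dots> = (\<Sum>y\<in>f ` A. P y ^ 2)"
    by (subst sum.reindex) auto
  finally have "real (card {(a, b). a \<in> A \<and> b \<in> A \<and> f a - f b = x}) \<le> (\<Sum>y\<in>f ` A. P y ^ 2)"
    by simp
  also have "\<dots> = real (card {(a, b). a \<in> A \<and> b \<in> A \<and> f a - f b = 0})"
    unfolding pairs by (simp add: power2_eq_square)
  finally show ?thesis by simp
qed

definition words :: "nat \<Rightarrow> (nat \<Rightarrow> int) set" where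
  "words n = {1..n} \<rightarrow>\<^sub>E {0, 1}"

definition word_value :: "real \<Rightarrow> nat \<Rightarrow> (nat \<Rightarrow> int) \<Rightarrow> real" where
  "word_value \<beta> n a = (\<Sum>i=1..n. of_int (a i) * \<beta> ^ (n - i))"

lemma finite_words [simp]: "finite (words n)"
  by (auto simp: words_def intro!: finite_PiE)

lemma N_altdef:
  "N \<beta> n x = card {(a, b). a \<in> words n \<and> b \<in> words n \<and> word_value \<beta> n a - word_value \<beta> n b = x}"
  by (simp add: N_def words_def word_value_def algebra_simps flip: sum_subtractf)

lemma N_le_N_0: "N \<beta> n x \<le> N \<beta> n 0"
  unfolding N_altdef by (rule card_shifted_pairs_le) simp

lemma N_sum: "real (N \<beta> n x) =
    (\<Sum>a\<in>words n. \<Sum>b\<in>words n. of_bool (word_value \<beta> n a - word_value \<beta> n b = x))"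
proof -
  have "{(a, b). a \<in> words n \<and> b \<in> words n \<and> word_value \<beta> n a - word_value \<beta> n b = x}
      = (SIGMA a:words n. {b \<in> words n. word_value \<beta> n a - word_value \<beta> n b = x})"
    by auto
  thus ?thesis by (simp add: N_altdef Int_def)
qed

lemma word_value_Suc:
  "word_value \<beta> (Suc n) (a(Suc n := e)) = \<beta> * word_value \<beta> n a + of_int e"
proof -
  have "(\<Sum>i=1..n. real_of_int ((a(Suc n := e)) i) * \<beta> ^ (Suc n - i))
      = (\<Sum>i=1..n. \<beta> * (of_int (a i) * \<beta> ^ (n - i)))"
    by (intro sum.cong) (auto simp: Suc_diff_le)
  thus ?thesis by (simp add: word_value_def sum_distrib_left)
qed

lemma sum_words_Suc:
  fixes h :: "(nat \<Rightarrow> int) \<Rightarrow> real"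
  shows "(\<Sum>a\<in>words (Suc n). h a) = (\<Sum>a\<in>words n. h (a(Suc n := 0)) + h (a(Suc n := 1)))"
proof -
  have "words (Suc n) = (\<lambda>(y, a). a(Suc n := y)) ` ({0, 1} \<times> words n)"
    by (simp add: words_def atLeastAtMostSuc_conv PiE_insert_eq)
  moreover have "inj_on (\<lambda>(y, a). a(Suc n := y)) ({0::int, 1} \<times> words n)"
    unfolding words_def by (rule inj_combinator) auto
  ultimately have "(\<Sum>a\<in>words (Suc n). h a) = (\<Sum>(y, a)\<in>{0, 1} \<times> words n. h (a(Suc n := y)))"
    by (simp add: sum.reindex case_prod_unfold)
  also have "\<dots> = (\<Sum>y\<in>{0, 1}. \<Sum>a\<in>words n. h (a(Suc n := y)))"
    by (rule sum.cartesian_product[symmetric])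
  finally show ?thesis by (simp add: sum.distrib)
qed

lemma N_pos_iff:
  "N \<beta> n x > 0 \<longleftrightarrow> (\<exists>a\<in>words n. \<exists>b\<in>words n. word_value \<beta> n a - word_value \<beta> n b = x)"
proof -
  have "finite {(a, b). a \<in> words n \<and> b \<in> words n \<and> word_value \<beta> n a - word_value \<beta> n b = x}"
    by (rule finite_subset[of _ "words n \<times> words n"]) auto
  thus ?thesis by (auto simp: N_altdef card_gt_0_iff)
qed

lemma N_0_eq: "N \<beta> 0 x = of_bool (x = 0)"
  by (auto simp: N_def)

text \<open>The one-step recursion, obtained by splitting off the last letters of the two words: their difference
is \<open>0\<close> in two ways and \<open>1\<close>, \<open>-1\<close> in one way each. Thus \<open>N \<beta> n x\<close> is the
weighted number of \<open>n\<close>-step paths from \<open>0\<close> to \<open>x\<close> with steps \<open>x \<mapsto> \<beta> * x + e\<close>, \<open>e\<close> in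
\<open>{-1, 0, 1}\<close>, where \<open>e = 0\<close> has weight \<open>2\<close>. All later arguments use this picture.\<close>

lemma N_Suc_eq:
  assumes "\<beta> \<noteq> 0"
  shows "real (N \<beta> (Suc n) y)
    = 2 * real (N \<beta> n (y / \<beta>)) + real (N \<beta> n ((y - 1) / \<beta>)) + real (N \<beta> n ((y + 1) / \<beta>))"
  using assms
  by (simp add: N_sum sum_words_Suc word_value_Suc sum.distrib[symmetric] sum_distrib_left field_simps
      del: sum_of_bool_eq sum_of_bool_mult_eq sum_mult_of_bool_eq)

lemma finite_N_support:
  assumes "\<beta> \<noteq> 0"
  shows "finite {x. N \<beta> n x > 0}"
proof (rule finite_subset)
  show "{x. N \<beta> n x > 0} \<subseteq> (\<lambda>(a, b). word_value \<beta> n a - word_value \<beta> n b) ` (words n \<times> words n)"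
  proof
    fix x assume "x \<in> {x. N \<beta> n x > 0}"
    thus "x \<in> (\<lambda>(a, b). word_value \<beta> n a - word_value \<beta> n b) ` (words n \<times> words n)"
      by (force simp: N_pos_iff)
  qed
qed simp

lemma X_iff: "x \<in> X \<beta> \<longleftrightarrow> (\<exists>n. N \<beta> n x > 0)"
proof
  assume "x \<in> X \<beta>"
  then obtain n c where x: "x = (\<Sum>i=1..n. of_int (c i) * \<beta> ^ (n - i))"
    and c: "\<And>i. i \<in> {1..n} \<Longrightarrow> c i \<in> {-1, 0, 1 :: int}"
    unfolding X_def by auto
  define a b where "a = restrict (\<lambda>i. if c i = 1 then 1 else 0 :: int) {1..n}"
    and "b = restrict (\<lambda>i. if c i = -1 then 1 else 0 :: int) {1..n}"
  have "a \<in> words n" "b \<in> words n" by (auto simp: a_def b_def words_def)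
  moreover have "word_value \<beta> n a - word_value \<beta> n b = x"
    unfolding x word_value_def sum_subtractf[symmetric]
  proof (rule sum.cong[OF refl])
    fix i assume i: "i \<in> {1..n}"
    show "of_int (a i) * \<beta> ^ (n - i) - of_int (b i) * \<beta> ^ (n - i) = of_int (c i) * \<beta> ^ (n - i)"
      using c[OF i] i by (auto simp: a_def b_def)
  qed
  ultimately have "N \<beta> n x > 0" by (auto simp: N_pos_iff)
  thus "\<exists>n. N \<beta> n x > 0" ..
next
  assume "\<exists>n. N \<beta> n x > 0"
  then obtain n where "N \<beta> n x > 0" ..
  then obtain a b where ab: "a \<in> words n" "b \<in> words n" and x: "word_value \<beta> n a - word_value \<beta> n b = x"
    by (auto simp: N_pos_iff)
  have "x = (\<Sum>i=1..n. of_int (a i - b i) * \<beta> ^ (n - i))"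
    unfolding x[symmetric] word_value_def by (simp add: algebra_simps sum_subtractf)
  moreover have "a i - b i \<in> {-1, 0, 1}" if "i \<in> {1..n}" for i
  proof -
    have "a i \<in> {0, 1}" "b i \<in> {0, 1}" using ab that unfolding words_def by (auto dest: PiE_mem)
    thus ?thesis by auto
  qed
  ultimately show "x \<in> X \<beta>"
    unfolding X_def mem_Collect_eq by (intro exI[of _ n] exI[of _ "\<lambda>i. a i - b i"]) simp
qed

text \<open>The Chapman-Kolmogorov equation for the path picture. Running \<open>m\<close> more steps from \<open>x\<close> leads to
\<open>\<beta> ^ m * x\<close> plus the endpoint of a path from \<open>0\<close>, so the second factor is again a value of \<open>N\<close>.\<close>

lemma N_add:
  assumes "\<beta> \<noteq> 0"
  shows "real (N \<beta> (n + m) y) =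
    (\<Sum>x | N \<beta> n x > 0. real (N \<beta> n x) * N \<beta> m (y - \<beta> ^ m * x))"
proof (induction m arbitrary: y)
  case 0
  have "(\<Sum>x | N \<beta> n x > 0. real (N \<beta> n x) * of_bool (y - x = 0))
      = (\<Sum>x | N \<beta> n x > 0. if x = y then real (N \<beta> n y) else 0)"
    by (intro sum.cong) auto
  also have "\<dots> = real (N \<beta> n y)"
    by (auto simp: finite_N_support[OF assms])
  finally show ?case by (simp add: N_0_eq)
next
  case (Suc m)
  have shift: "(y + e) / \<beta> - \<beta> ^ m * x = (y - \<beta> ^ Suc m * x + e) / \<beta>" for e x
    using assms by (simp add: field_simps)
  show ?case
    using shift[of 0] shift[of 1] shift[of "-1"]
    by (simp add: N_Suc_eq[OF assms] Suc sum_distrib_left distrib_left sum.distrib mult_ac)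
qed

section \<open>Algebraic integers with bounded conjugates\<close>

definition rat_eval :: "rat poly \<Rightarrow> 'a::field_char_0 \<Rightarrow> 'a" where
  "rat_eval F z = poly (map_poly of_rat F) z"

lemma rat_eval_0 [simp]: "rat_eval 0 z = 0"
  and rat_eval_pCons [simp]: "rat_eval (pCons c F) z = of_rat c + z * rat_eval F z"
  by (auto simp: rat_eval_def map_poly_pCons)

lemma rat_eval_1 [simp]: "rat_eval 1 z = 1"
  by (simp add: one_pCons)

lemma rat_eval_add [simp]: "rat_eval (F + G) z = rat_eval F z + rat_eval G z"
  by (induction F G rule: poly_induct2) (auto simp: of_rat_add algebra_simps)

lemma rat_eval_smult [simp]: "rat_eval (smult c F) z = of_rat c * rat_eval F z"
  by (induction F) (auto simp: of_rat_mult algebra_simps)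

lemma rat_eval_mult [simp]: "rat_eval (F * G) z = rat_eval F z * rat_eval G z"
  by (induction F) (auto simp: algebra_simps)

lemma rat_eval_diff [simp]: "rat_eval (F - G) z = rat_eval F z - rat_eval G z"
  using rat_eval_add[of "F - G" G z] by simp

lemma rat_eval_sum [simp]: "rat_eval (sum F A) z = (\<Sum>i\<in>A. rat_eval (F i) z)"
  by (induction A rule: infinite_finite_induct) auto

lemma rat_eval_monom [simp]: "rat_eval (monom c n) z = of_rat c * z ^ n"
  by (induction n) (auto simp: monom_0 monom_Suc algebra_simps)

lemma rat_eval_altdef: "degree F < n \<Longrightarrow> rat_eval F z = (\<Sum>i<n. of_rat (coeff F i) * z ^ i)"
  by (subst (1) poly_as_sum_of_monoms'[of F "n - 1", symmetric])
     (auto simp: lessThan_Suc_atMost[symmetric] simp del: lessThan_Suc)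

lemma rat_eval_mod:
  assumes "rat_eval g z = 0"
  shows "rat_eval (F mod g) z = rat_eval F z"
proof -
  have "rat_eval F z = rat_eval (F div g * g + F mod g) z" by simp
  also have "\<dots> = rat_eval (F mod g) z" using assms by (simp only: rat_eval_add rat_eval_mult) simp
  finally show ?thesis by simp
qed

lemma rat_eval_eq_0_if_dvd: "g dvd F \<Longrightarrow> rat_eval g z = 0 \<Longrightarrow> rat_eval F z = 0"
  by (auto elim!: dvdE)

text \<open>An annihilating polynomial of least degree generates all of them, by division with remainder.\<close>

lemma annihilator_generator:
  fixes z :: "'a::field_char_0"
  assumes "F \<noteq> 0" "rat_eval F z = 0"
  obtains g where "lead_coeff g = 1" "irreducible g" "\<And>F. rat_eval F z = 0 \<longleftrightarrow> g dvd F"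
proof -
  obtain g0 where g0: "g0 \<noteq> 0" "rat_eval g0 z = 0"
    and least: "\<And>F. F \<noteq> 0 \<Longrightarrow> rat_eval F z = 0 \<Longrightarrow> degree g0 \<le> degree F"
    using ex_has_least_nat[of "\<lambda>F. F \<noteq> 0 \<and> rat_eval F z = 0" F degree] assms by blast
  define g where "g = smult (inverse (lead_coeff g0)) g0"
  have lc: "lead_coeff g = 1" and nz: "g \<noteq> 0" and deg: "degree g = degree g0"
    and root: "rat_eval g z = 0"
    using g0 by (auto simp: g_def)
  have dvd: "rat_eval F z = 0 \<longleftrightarrow> g dvd F" for F
  proof
    assume "rat_eval F z = 0"
    hence "rat_eval (F mod g) z = 0" using rat_eval_mod[OF root] by simp
    moreover have "F mod g = 0 \<or> degree (F mod g) < degree g"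
      using degree_mod_less[OF nz] by blast
    ultimately have "F mod g = 0"
      using least[of "F mod g"] deg by (metis not_less)
    thus "g dvd F" by (rule mod_0_imp_dvd)
  qed (use root rat_eval_eq_0_if_dvd in blast)
  have "irreducible g"
  proof (rule irreducibleI)
    show "g \<noteq> 0" by (rule nz)
    show "\<not> g dvd 1" using dvd[of 1] by simp
    fix a b assume ab: "g = a * b"
    have *: "b dvd 1" if "g dvd a" "g = a * b" for a b
    proof -
      have "a * b dvd a * 1" using that by simp
      thus ?thesis using nz that(2) by (subst (asm) dvd_mult_cancel_left) auto
    qed
    have "g dvd a \<or> g dvd b"
      using dvd[of a] dvd[of b] root ab by auto
    thus "a dvd 1 \<or> b dvd 1"
      using *[of a b] *[of b a] ab by (auto simp: mult.commute)
  qed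
  thus ?thesis using that lc dvd by blast
qed

text \<open>If \<open>z\<close> were a root of \<open>g\<close> and of its derivative, the generator of the annihilators of \<open>z\<close> would divide
both. As \<open>g\<close> is irreducible, \<open>g\<close> itself would then divide its derivative, which has smaller degree.\<close>

lemma irreducible_root_simple:
  fixes z :: "'a::field_char_0"
  assumes g: "irreducible g" "rat_eval g z = 0"
  shows "rat_eval (pderiv g) z \<noteq> 0"
proof
  assume "rat_eval (pderiv g) z = 0"
  have nz: "g \<noteq> 0" using g(1) by auto
  obtain h where h: "\<And>F. rat_eval F z = 0 \<longleftrightarrow> h dvd F"
    using annihilator_generator[OF nz g(2)] by metis
  have "h dvd g" using h g(2) by blast
  then obtain k where k: "g = h * k" by blast
  have "\<not> h dvd 1" using h[of 1] by simp
  hence "k dvd 1" using irreducibleD[OF g(1) k] by blast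
  hence "g dvd h" using k by (metis mult_dvd_mono dvd_refl mult.right_neutral)
  hence "g dvd pderiv g" using h \<open>rat_eval (pderiv g) z = 0\<close> by (metis dvd_trans)
  moreover have "degree g \<noteq> 0"
  proof
    assume "degree g = 0"
    then obtain c where "g = [:c:]" by (rule degree_eq_zeroE)
    thus False using g(2) nz by simp
  qed
  moreover from this have "pderiv g \<noteq> 0" by (simp add: pderiv_eq_0_iff)
  ultimately have "degree g \<le> degree (pderiv g)" by (intro dvd_imp_degree_le)
  thus False using \<open>degree g \<noteq> 0\<close> by (simp add: degree_pderiv)
qed

lemma degree_map_of_rat [simp]: "degree (map_poly (of_rat :: rat \<Rightarrow> 'a::field_char_0) F) = degree F"
  by (rule degree_map_poly) simp

lemma card_complex_roots_irreducible:
  assumes "irreducible g"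
  shows "card {z :: complex. rat_eval g z = 0} = degree g"
proof -
  define G :: "complex poly" where "G = map_poly of_rat g"
  have G: "G \<noteq> 0" using assms by (auto simp: G_def map_poly_eq_0_iff)
  have "pderiv G = map_poly of_rat (pderiv g)"
    by (intro poly_eqI) (simp add: G_def coeff_pderiv coeff_map_poly of_rat_mult of_rat_add)
  hence "rsquarefree G"
    using irreducible_root_simple[OF assms] by (auto simp: rsquarefree_roots G_def rat_eval_def)
  hence "smult (lead_coeff G) (\<Prod>z|poly G z = 0. [:-z, 1:]) = G"
    by (rule complex_poly_decompose_rsquarefree)
  hence "degree G = degree (\<Prod>z|poly G z = 0. [:-z, 1:])"
    using G by (metis degree_smult_eq leading_coeff_0_iff)
  also have "\<dots> = card {z. poly G z = 0}"
    by (subst degree_prod_eq_sum_degree) auto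
  finally show ?thesis by (simp add: G_def rat_eval_def)
qed

lemma cmod_of_rat: "cmod (of_rat x) = \<bar>of_rat x\<bar>"
  by (cases x) (simp add: of_rat_rat norm_divide)

text \<open>By Lagrange interpolation the coefficients of \<open>R\<close> are fixed linear combinations of its values on \<open>Z\<close>.\<close>

lemma coeff_bound_from_values:
  fixes Z :: "complex set" and B :: "complex \<Rightarrow> real"
  assumes "finite Z"
  obtains C :: "nat \<Rightarrow> real" where
    "\<And>R i. degree R < card Z \<Longrightarrow> (\<And>z. z \<in> Z \<Longrightarrow> cmod (poly R z) \<le> B z) \<Longrightarrow> cmod (coeff R i) \<le> C i"
proof -
  \<comment> \<open>The Lagrange basis polynomials.\<close>
  define L where "L z = (\<Prod>w\<in>Z-{z}. smult (1 / (z - w)) [:-w, 1:])" for z :: complex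
  have L: "poly (L z) w = (if w = z then 1 else 0)" if "z \<in> Z" "w \<in> Z" for z w
  proof -
    have "poly (L z) w = (\<Prod>v\<in>Z-{z}. (w - v) / (z - v))"
      by (simp add: L_def poly_prod diff_divide_distrib)
    thus ?thesis using that assms by (auto intro!: prod.neutral)
  qed
  have deg_L: "degree (L z) \<le> card Z - 1" if "z \<in> Z" for z
  proof -
    have "degree (L z) \<le> (\<Sum>w\<in>Z-{z}. degree (smult (1 / (z - w)) [:-w, 1:]))"
      unfolding L_def using degree_prod_sum_le[of "Z - {z}" "\<lambda>w. smult (1 / (z - w)) [:-w, 1:]"] assms
      by (simp add: o_def)
    also have "\<dots> \<le> (\<Sum>w\<in>Z-{z}. 1)"
      by (intro sum_mono) (auto intro: order.trans[OF degree_smult_le])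
    finally show ?thesis using that assms by simp
  qed
  have "cmod (coeff R i) \<le> (\<Sum>z\<in>Z. B z * cmod (coeff (L z) i))"
    if R: "degree R < card Z" "\<And>z. z \<in> Z \<Longrightarrow> cmod (poly R z) \<le> B z" for R i
  proof -
    have "R = (\<Sum>z\<in>Z. smult (poly R z) (L z))"
    proof (rule poly_eqI_degree[of Z])
      fix w assume "w \<in> Z"
      have "poly (\<Sum>z\<in>Z. smult (poly R z) (L z)) w = (\<Sum>z\<in>Z. if z = w then poly R w else 0)"
        unfolding poly_sum by (intro sum.cong) (use \<open>w \<in> Z\<close> in \<open>auto simp: L\<close>)
      thus "poly R w = poly (\<Sum>z\<in>Z. smult (poly R z) (L z)) w"
        using \<open>w \<in> Z\<close> assms by simp
    next
      have "degree (\<Sum>z\<in>Z. smult (poly R z) (L z)) \<le> card Z - 1"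
        using assms deg_L by (intro degree_sum_le) (auto intro: order.trans[OF degree_smult_le])
      thus "degree (\<Sum>z\<in>Z. smult (poly R z) (L z)) < card Z" using R(1) by simp
    qed (use R in auto)
    hence "coeff R i = (\<Sum>z\<in>Z. poly R z * coeff (L z) i)"
      by (metis (mono_tags, lifting) coeff_smult coeff_sum sum.cong)
    also have "cmod \<dots> \<le> (\<Sum>z\<in>Z. B z * cmod (coeff (L z) i))"
      by (intro sum_norm_le) (auto simp: norm_mult intro!: mult_right_mono R(2))
    finally show ?thesis .
  qed
  thus ?thesis by (rule that)
qed

text \<open>As \<open>P\<close> is monic, a leading term can be cancelled by a multiple of \<open>P\<close> without dividing its coefficient.\<close>

lemma integral_reduction:
  fixes F P :: "rat poly"
  assumes P: "lead_coeff P = 1" "\<And>i. coeff P i \<in> \<int>" "degree P > 0"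
    and F: "\<And>i. coeff F i \<in> \<int>"
  shows "\<exists>r. (\<forall>i. coeff r i \<in> \<int>) \<and> degree r < degree P \<and> P dvd F - r"
  using F
proof (induction F)
  case 0
  show ?case using P(3) by (intro exI[of _ 0]) auto
next
  case (pCons c F)
  have "coeff F i \<in> \<int>" for i using pCons.prems[of "Suc i"] by simp
  then obtain r where r: "\<And>i. coeff r i \<in> \<int>" "degree r < degree P" "P dvd F - r"
    using pCons.IH by blast
  have c: "c \<in> \<int>" using pCons.prems[of 0] by simp
  define D where "D = degree P"
  define r' where "r' = pCons c r - smult (coeff r (D - 1)) P"
  have "coeff r' i = 0" if "i \<ge> D" for i
  proof (cases "i = D")
    case True
    thus ?thesis using P(1,3) by (simp add: r'_def D_def coeff_pCons split: nat.splits)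
  next
    case False
    hence "i > D" using that by simp
    moreover have "coeff r (i - 1) = 0" using r(2) \<open>i > D\<close> by (intro coeff_eq_0) (auto simp: D_def)
    ultimately show ?thesis by (auto simp: r'_def D_def coeff_pCons coeff_eq_0 split: nat.splits)
  qed
  hence "degree r' < D" using P(3) D_def
    by (metis degree_lessI)
  moreover have "coeff r' i \<in> \<int>" for i
    using c r(1) P(2) by (auto simp: r'_def coeff_pCons split: nat.splits)
  moreover have "pCons c F - r' = [:0,1:] * (F - r) + smult (coeff r (D - 1)) P"
    by (simp add: r'_def)
  hence "P dvd pCons c F - r'"
    using r(3) by (simp only:) (intro dvd_add dvd_mult dvd_smult dvd_refl)
  ultimately show ?case by (auto simp: D_def)
qed

lemma common_denominator:
  assumes "finite (A :: rat set)"
  obtains q :: nat where "q > 0" "\<And>x. x \<in> A \<Longrightarrow> of_nat q * x \<in> \<int>"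
proof -
  from assms have "\<exists>q::nat. q > 0 \<and> (\<forall>x\<in>A. of_nat q * x \<in> \<int>)"
  proof (induction A)
    case empty
    show ?case by (intro exI[of _ 1]) auto
  next
    case (insert a A)
    then obtain q :: nat where q: "q > 0" "\<forall>x\<in>A. of_nat q * x \<in> \<int>" by blast
    obtain m n where mn: "quotient_of a = (m, n)" by force
    have n: "n > 0" "a = of_int m / of_int n"
      using quotient_of_denom_pos[OF mn] quotient_of_div[OF mn] by auto
    have "of_nat (q * nat n) * a = of_nat q * of_int m"
      using n by simp
    hence "of_nat (q * nat n) * a \<in> \<int>" by (metis Ints_mult Ints_of_nat Ints_of_int)
    moreover have "of_nat (q * nat n) * x \<in> \<int>" if "x \<in> A" for x
    proof -
      have "of_nat (q * nat n) * x = of_nat (nat n) * (of_nat q * x)" by simp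
      thus ?thesis using q(2) that by (metis Ints_mult Ints_of_nat)
    qed
    ultimately show ?case using q(1) n(1) by (intro exI[of _ "q * nat n"]) auto
  qed
  thus ?thesis using that by blast
qed

lemma rat_eval_sum_monom_mod:
  assumes "degree r < D" "rat_eval g z = 0"
  shows "rat_eval (\<Sum>i<D. smult (coeff r i) (monom 1 i mod g)) z = rat_eval r z"
  using rat_eval_altdef[OF assms(1), of z] by (simp add: rat_eval_mod[OF assms(2)])

text \<open>The elements of \<open>\<int>[\<beta>]\<close> whose conjugates obey fixed bounds form a finite set. Such an element can be written as
\<open>R(\<beta>)\<close> with \<open>degree R < degree g\<close>: reduce first modulo \<open>P\<close>, which keeps the coefficients integral, and
then modulo \<open>g\<close>, which introduces only denominators dividing a fixed \<open>q\<close>, because only the finitely many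
powers below \<open>degree P\<close> have to be reduced. The values of \<open>R\<close> at the roots of \<open>g\<close> are the
conjugates; as there are \<open>degree g\<close> of these roots, interpolation bounds the coefficients of \<open>R\<close>, which
lie in \<open>(1/q)\<int>\<close>.\<close>

lemma finite_bounded_conjugates:
  fixes \<beta> :: real and B :: "complex \<Rightarrow> real"
  assumes P: "lead_coeff P = 1" "\<And>i. coeff P i \<in> \<int>" "rat_eval P \<beta> = 0"
    and g: "irreducible g" "rat_eval g \<beta> = 0" "g dvd P"
  shows "finite {rat_eval F \<beta> | F. (\<forall>i. coeff F i \<in> \<int>) \<and>
            (\<forall>z::complex. rat_eval g z = 0 \<longrightarrow> cmod (rat_eval F z) \<le> B z)}" (is "finite ?S")
proof -
  define Z where "Z = {z::complex. rat_eval g z = 0}"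
  define d where "d = degree g"
  define D where "D = degree P"
  have card_Z: "card Z = d"
    unfolding Z_def d_def by (rule card_complex_roots_irreducible[OF g(1)])
  have g_nz: "g \<noteq> 0" using g(1) by auto
  have "d \<noteq> 0"
  proof
    assume "d = 0"
    then obtain c where "g = [:c:]" unfolding d_def by (rule degree_eq_zeroE)
    thus False using g(2) g_nz by simp
  qed
  hence d: "d > 0" by simp
  have P_nz: "P \<noteq> 0" using P(1) by auto
  have "d \<le> D" unfolding d_def D_def using g(3) P_nz by (rule dvd_imp_degree_le)
  hence D: "D > 0" using d by simp
  have "finite Z" using card_Z d by (metis card.infinite less_irrefl)
  then obtain C where C: "\<And>R i. degree R < card Z \<Longrightarrow>
      (\<And>z. z \<in> Z \<Longrightarrow> cmod (poly R z) \<le> B z) \<Longrightarrow> cmod (coeff R i) \<le> C i"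
    using coeff_bound_from_values[of Z B] by blast
  define M where "M i = monom 1 i mod g" for i
  have deg_M: "degree (M i) < d" for i
    using degree_mod_less[OF g_nz, of "monom 1 i"] d by (auto simp: M_def d_def)
  have deg_M': "degree (M i) \<le> d - 1" for i
    using deg_M[of i] by simp
  obtain q :: nat where q: "q > 0"
    "\<And>x. x \<in> (\<lambda>(i,j). coeff (M i) j) ` ({..<D} \<times> {..<d}) \<Longrightarrow> of_nat q * x \<in> \<int>"
    using common_denominator[of "(\<lambda>(i,j). coeff (M i) j) ` ({..<D} \<times> {..<d})"] by auto
  have q': "of_nat q * coeff (M i) j \<in> \<int>" if "i < D" "j < d" for i j
    using that by (intro q(2)) auto
  define T where "T = (\<Pi>\<^sub>E j\<in>{..<d}. {k::int. \<bar>real_of_int k\<bar> \<le> q * C j})"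
  define val where "val f = (\<Sum>j<d. of_int (f j) / real q * \<beta> ^ j)" for f :: "nat \<Rightarrow> int"
  have "finite {k::int. \<bar>real_of_int k\<bar> \<le> b}" for b :: real
  proof (rule finite_subset)
    show "{k::int. \<bar>real_of_int k\<bar> \<le> b} \<subseteq> {-\<lceil>b\<rceil>..\<lceil>b\<rceil>}" by (auto; linarith)
  qed auto
  hence "finite T" unfolding T_def by (intro finite_PiE) auto
  moreover have "?S \<subseteq> val ` T"
  proof safe
    fix F assume F: "\<forall>i. coeff F i \<in> \<int>"
      "\<forall>z::complex. rat_eval g z = 0 \<longrightarrow> cmod (rat_eval F z) \<le> B z"
    obtain r where r: "\<And>i. coeff r i \<in> \<int>" "degree r < D" "P dvd F - r"
      using integral_reduction[OF P(1,2), of F] F(1) D by (auto simp: D_def)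
    \<comment> \<open>The reduction of \<open>r\<close> modulo \<open>g\<close>, with the reduced monomials kept visible.\<close>
    define R where "R = (\<Sum>i<D. smult (coeff r i) (M i))"
    have g_dvd: "g dvd F - r" using g(3) r(3) by (rule dvd_trans)
    have R_eval: "rat_eval R z = rat_eval F z" if "rat_eval g z = 0" for z :: complex
      using rat_eval_sum_monom_mod[OF r(2) that] rat_eval_eq_0_if_dvd[OF g_dvd that]
      by (simp add: R_def M_def)
    have R_eval_\<beta>: "rat_eval R \<beta> = rat_eval F \<beta>"
      using rat_eval_sum_monom_mod[OF r(2) g(2)] rat_eval_eq_0_if_dvd[OF g_dvd g(2)]
      by (simp add: R_def M_def)
    have "degree R \<le> d - 1"
      unfolding R_def using deg_M'
      by (intro degree_sum_le) (auto intro: order.trans[OF degree_smult_le])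
    hence deg_R: "degree R < d" using d by simp
    have bound: "\<bar>of_rat (coeff R j)\<bar> \<le> C j" for j
    proof -
      have "cmod (coeff (map_poly of_rat R) j) \<le> C j"
      proof (rule C)
        show "degree (map_poly of_rat R :: complex poly) < card Z"
          using deg_R card_Z by simp
        fix z assume "z \<in> Z"
        thus "cmod (poly (map_poly of_rat R) z) \<le> B z"
          using R_eval[of z] F(2) by (simp add: Z_def rat_eval_def)
      qed
      thus ?thesis by (simp add: coeff_map_poly cmod_of_rat)
    qed
    have "of_nat q * coeff R j \<in> \<int>" if "j < d" for j
    proof -
      have "of_nat q * coeff R j = (\<Sum>i<D. coeff r i * (of_nat q * coeff (M i) j))"
        by (simp add: R_def coeff_sum sum_distrib_left mult_ac)
      also have "\<dots> \<in> \<int>"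
        using q' that by (intro Ints_sum Ints_mult[OF r(1)]) auto
      finally show ?thesis .
    qed
    hence "\<forall>j\<in>{..<d}. \<exists>k::int. of_nat q * coeff R j = of_int k"
      by (auto elim!: Ints_cases)
    then obtain f where f: "\<And>j. j < d \<Longrightarrow> of_nat q * coeff R j = of_int (f j)"
      by (metis lessThan_iff)
    have f': "real q * of_rat (coeff R j) = of_int (f j)" if "j < d" for j
      using arg_cong[OF f[OF that], of "of_rat :: rat \<Rightarrow> real"] by (simp add: of_rat_mult)
    have "rat_eval F \<beta> = rat_eval R \<beta>" using R_eval_\<beta> by simp
    also have "\<dots> = (\<Sum>j<d. of_rat (coeff R j) * \<beta> ^ j)" by (rule rat_eval_altdef[OF deg_R])
    also have "\<dots> = val (restrict f {..<d})"
      unfolding val_def using f' q(1) by (intro sum.cong) (auto simp: field_simps)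
    finally have "rat_eval F \<beta> = val (restrict f {..<d})" .
    moreover have "restrict f {..<d} \<in> T"
      using f' bound q(1) by (auto simp: T_def abs_mult simp flip: f' intro!: mult_left_mono)
    ultimately show "rat_eval F \<beta> \<in> val ` T" by blast
  qed
  ultimately show ?thesis
    by - (rule finite_subset, assumption, rule finite_imageI)
qed

text \<open>Values at \<open>\<beta>\<close> of these polynomials are the endpoints of the \<open>n\<close>-step paths from \<open>0\<close>. Bounding the
indices of the nonzero coefficients, rather than the degree, leaves only the zero polynomial for \<open>n = 0\<close>.\<close>

definition sign_poly :: "nat \<Rightarrow> rat poly \<Rightarrow> bool" where
  "sign_poly n F \<longleftrightarrow> (\<forall>i. coeff F i \<in> {-1, 0, 1}) \<and> (\<forall>i\<ge>n. coeff F i = 0)"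

lemma norm_rat_eval_sign_poly_le:
  assumes "sign_poly n F"
  shows "cmod (rat_eval F z) \<le> (\<Sum>i<n. cmod z ^ i)"
proof (cases "n = 0")
  case True
  hence "F = 0" using assms by (intro poly_eqI) (auto simp: sign_poly_def)
  thus ?thesis using True by simp
next
  case False
  hence "degree F < n" using assms by (intro degree_lessI) (auto simp: sign_poly_def)
  hence "rat_eval F z = (\<Sum>i<n. of_rat (coeff F i) * z ^ i)" by (rule rat_eval_altdef)
  also have "cmod \<dots> \<le> (\<Sum>i<n. cmod z ^ i)"
  proof (rule sum_norm_le)
    fix i
    have "coeff F i \<in> {-1, 0, 1}" using assms by (simp add: sign_poly_def)
    hence "cmod (of_rat (coeff F i)) \<le> 1" by auto
    thus "cmod (of_rat (coeff F i) * z ^ i) \<le> cmod z ^ i"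
      by (simp add: norm_mult norm_power mult_left_le_one_le)
  qed
  finally show ?thesis .
qed

text \<open>Only finitely many points lie on a path that starts in \<open>0\<close> and ends in \<open>0\<close>: here \<open>F\<close> describes the path from
\<open>0\<close> to the point and \<open>G\<close> the digits of the path back. This is where hyperbolicity enters. At a conjugate \<open>z\<close> of
modulus less than one, \<open>F z\<close> is bounded by a geometric series. At a conjugate of modulus greater than one,
the relation \<open>z ^ m * F z = - G z\<close>, which \<open>z\<close> inherits from \<open>\<beta>\<close>, bounds \<open>F z\<close>. Conjugates of
modulus one, for which neither bound is available, are excluded.\<close>

lemma hyperbolic_finite_recurrent:
  assumes "hyperbolic \<beta>"
  shows "finite {rat_eval F \<beta> | F. \<exists>n m G. sign_poly n F \<and> sign_poly m G \<and> \<beta> ^ m * rat_eval F \<beta> + rat_eval G \<beta> = 0}"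
    (is "finite ?V")
proof -
  have "algebraic_int \<beta>" using assms by (simp add: hyperbolic_def)
  then obtain p where p: "poly (map_poly of_int p) \<beta> = 0" "lead_coeff p = 1"
    unfolding algebraic_int_altdef_ipoly by blast
  define P :: "rat poly" where "P = map_poly of_int p"
  have P: "lead_coeff P = 1" "\<And>i. coeff P i \<in> \<int>" "rat_eval P \<beta> = 0"
    using p by (auto simp: P_def rat_eval_def map_poly_map_poly o_def coeff_map_poly degree_map_poly)
  have "P \<noteq> 0" using P(1) by auto
  then obtain g where g: "lead_coeff g = 1" "irreducible g" "\<And>F. rat_eval F \<beta> = 0 \<longleftrightarrow> g dvd F"
    using annihilator_generator[OF _ P(3)] by metis
  have g_root: "rat_eval g \<beta> = 0" by (simp add: g(3))
  have "minimal_polynomial g \<beta>"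
    using g(1,2) g_root by (simp add: minimal_polynomial_def rat_eval_def)
  hence conj: "cmod z \<noteq> 1" if "rat_eval g z = 0" for z
    using assms that by (auto simp: hyperbolic_def galois_conjugate_def rat_eval_def)
  define B where "B z = 1 / \<bar>1 - cmod z\<bar>" for z
  have "?V \<subseteq> {rat_eval F \<beta> | F. (\<forall>i. coeff F i \<in> \<int>) \<and>
            (\<forall>z::complex. rat_eval g z = 0 \<longrightarrow> cmod (rat_eval F z) \<le> B z)}"
  proof (clarify, intro exI conjI allI impI)
    fix F G n m assume F: "sign_poly n F" and G: "sign_poly m G"
      and ret: "\<beta> ^ m * rat_eval F \<beta> + rat_eval G \<beta> = 0"
    show "coeff F i \<in> \<int>" for i
    proof -
      have "coeff F i \<in> {-1, 0, 1}" using F by (simp add: sign_poly_def)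
      thus ?thesis by auto
    qed
    fix z :: complex assume z: "rat_eval g z = 0"
    consider "cmod z < 1" | "cmod z > 1" using conj[OF z] by linarith
    thus "cmod (rat_eval F z) \<le> B z"
    proof cases
      case 1
      have "cmod (rat_eval F z) \<le> (\<Sum>i<n. cmod z ^ i)" by (rule norm_rat_eval_sign_poly_le[OF F])
      also have "\<dots> = (1 - cmod z ^ n) / (1 - cmod z)"
        using 1 by (simp add: sum_gp_strict)
      also have "\<dots> \<le> B z" using 1 by (auto simp: B_def intro!: divide_right_mono)
      finally show ?thesis .
    next
      case 2
      have "rat_eval (monom 1 m * F + G) \<beta> = 0" using ret by simp
      hence "rat_eval (monom 1 m * F + G) z = 0"
        using g(3) z rat_eval_eq_0_if_dvd by blast
      hence "z ^ m * rat_eval F z = - rat_eval G z" by (simp add: add_eq_0_iff)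
      hence "cmod z ^ m * cmod (rat_eval F z) = cmod (rat_eval G z)"
        by (metis norm_minus_cancel norm_mult norm_power)
      also have "\<dots> \<le> (\<Sum>i<m. cmod z ^ i)" by (rule norm_rat_eval_sign_poly_le[OF G])
      also have "\<dots> = (cmod z ^ m - 1) / (cmod z - 1)"
        using 2 by (simp add: sum_gp_strict field_simps)
      also have "\<dots> \<le> cmod z ^ m * B z" using 2 by (simp add: B_def divide_right_mono)
      finally show ?thesis using 2 by (subst (asm) mult_le_cancel_left_pos) (auto intro!: zero_less_power)
    qed
  qed (rule refl)
  thus ?thesis
    using finite_bounded_conjugates[OF P g(2) g_root] g(3) P(3) finite_subset by blast
qed

section \<open>The renewal theorem\<close>

text \<open>Dominated convergence (Tannery's theorem) for convolutions. The map \<open>\<phi>\<close> allows the limit to be taken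
along a subsequence.\<close>

lemma convolution_tendsto:
  fixes g u :: "nat \<Rightarrow> real" and \<phi> :: "'i \<Rightarrow> nat"
  assumes g: "summable g" "\<And>k. 0 \<le> g k"
    and u: "\<And>n. \<bar>u n\<bar> \<le> B"
    and F: "F \<noteq> bot" "filterlim \<phi> at_top F"
    and lim: "\<And>k. ((\<lambda>j. u (\<phi> j - k)) \<longlongrightarrow> c k) F"
  shows "((\<lambda>j. \<Sum>k\<le>\<phi> j. g k * u (\<phi> j - k)) \<longlongrightarrow> (\<Sum>k. g k * c k)) F"
proof -
  define a where "a k j = (if k \<le> \<phi> j then g k * u (\<phi> j - k) else 0)" for k j
  have B: "0 \<le> B"
    using u[of 0] by linarith
  have ev: "eventually (\<lambda>j. k \<le> \<phi> j) F" for k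
    using F(2) by (auto simp: filterlim_at_top)
  have "((\<lambda>j. a k j) \<longlongrightarrow> g k * c k) F" for k
  proof (rule Lim_transform_eventually)
    show "((\<lambda>j. g k * u (\<phi> j - k)) \<longlongrightarrow> g k * c k) F"
      by (intro tendsto_intros lim)
    show "eventually (\<lambda>j. g k * u (\<phi> j - k) = a k j) F"
      using ev[of k] by eventually_elim (simp add: a_def)
  qed
  moreover have "norm (a k j) \<le> B * g k" for k j
    using mult_left_mono[OF u[of "\<phi> j - k"] g(2)[of k]] B g(2)[of k]
    by (auto simp: a_def abs_mult mult.commute)
  moreover have "summable (\<lambda>k. B * g k)"
    using g(1) by (rule summable_mult)
  ultimately have "((\<lambda>j. \<Sum>k. a k j) \<longlongrightarrow> (\<Sum>k. g k * c k)) F"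
    using tannerys_theorem[of a "\<lambda>k. g k * c k" F "\<lambda>k. B * g k"] F(1)
    by (simp add: case_prod_unfold)
  moreover have "(\<Sum>k. a k j) = (\<Sum>k\<le>\<phi> j. g k * u (\<phi> j - k))" for j
    by (subst suminf_finite[of "{..\<phi> j}"]) (auto simp: a_def)
  ultimately show ?thesis by simp
qed

text \<open>The recursion says that the convolution of \<open>b\<close> with the tails \<open>1 - (g 0 + \<dots> + g k)\<close> does not change from
\<open>n\<close> to \<open>n + 1\<close>.\<close>

lemma renewal_tail_identity:
  fixes g b :: "nat \<Rightarrow> real"
  assumes g0: "g 0 = 0"
    and rec: "\<And>n. b (Suc n) = (\<Sum>k\<le>Suc n. g k * b (Suc n - k))"
  shows "(\<Sum>k\<le>n. (1 - (\<Sum>i\<le>k. g i)) * b (n - k)) = b 0"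
proof (induction n)
  case 0
  show ?case using g0 by simp
next
  case (Suc n)
  have "(\<Sum>k\<le>Suc n. (1 - (\<Sum>i\<le>k. g i)) * b (Suc n - k))
      = b (Suc n) + (\<Sum>k\<le>n. (1 - (\<Sum>i\<le>Suc k. g i)) * b (n - k))"
    by (subst sum.atMost_Suc_shift) (simp add: g0)
  also have "(\<Sum>k\<le>n. (1 - (\<Sum>i\<le>Suc k. g i)) * b (n - k))
      = (\<Sum>k\<le>n. (1 - (\<Sum>i\<le>k. g i)) * b (n - k)) - (\<Sum>k\<le>n. g (Suc k) * b (n - k))"
    by (simp add: algebra_simps flip: sum_subtractf)
  also have "(\<Sum>k\<le>n. g (Suc k) * b (n - k)) = b (Suc n)"
    by (subst rec, subst sum.atMost_Suc_shift) (simp add: g0)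
  finally show ?case using Suc by simp
qed

lemma bounded_limsup_subseq:
  fixes b :: "nat \<Rightarrow> real"
  assumes "\<And>n. \<bar>b n\<bar> \<le> B"
  obtains s \<phi> where "strict_mono \<phi>" "(\<lambda>j. b (\<phi> j)) \<longlonglongrightarrow> s"
    "\<forall>\<eta>>0. eventually (\<lambda>n. b n < s + \<eta>) sequentially"
proof -
  obtain \<phi> where \<phi>: "strict_mono \<phi>" "((\<lambda>n. ereal (b n)) \<circ> \<phi>) \<longlonglongrightarrow> limsup (\<lambda>n. ereal (b n))"
    using limsup_subseq_lim[of "\<lambda>n. ereal (b n)"] by blast
  have "limsup (\<lambda>n. ereal (b n)) \<le> ereal B"
    by (intro Limsup_bounded always_eventually) (use assms abs_le_iff in auto)
  moreover have "ereal (- B) \<le> b n" for n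
    using assms[of n] by simp
  hence "ereal (- B) \<le> limsup (\<lambda>n. ereal (b n))"
    by (intro le_Limsup always_eventually) auto
  ultimately obtain s where s: "limsup (\<lambda>n. ereal (b n)) = ereal s"
    by (cases "limsup (\<lambda>n. ereal (b n))") auto
  have "eventually (\<lambda>n. b n < s + \<eta>) sequentially" if "\<eta> > 0" for \<eta>
    using Limsup_lessD[of sequentially "\<lambda>n. ereal (b n)" "ereal (s + \<eta>)"] s that
    by simp
  moreover have "(\<lambda>j. b (\<phi> j)) \<longlonglongrightarrow> s"
    using \<phi>(2) by (simp add: s o_def)
  ultimately show ?thesis
    using that \<phi>(1) by blast
qed

text \<open>The upper limit \<open>s\<close> of \<open>b\<close> is attained along a subsequence \<open>\<phi>\<close>. Up to a small error,
\<open>b n\<close> is an average of late values, which are essentially at most \<open>s\<close>; as the weight \<open>g 1\<close> of \<open>b (n - 1)\<close> is positive,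
\<open>b (\<phi> j - 1)\<close> converges to \<open>s\<close> as well, and inductively so does \<open>b (\<phi> j - k)\<close> for every \<open>k\<close>. Passing to
the limit in the tail identity along \<open>\<phi>\<close> gives \<open>suminf r * s = b 0\<close>. Applied to \<open>- b\<close>, the lemma bounds
the lower limit.\<close>

lemma renewal_limsup_le:
  fixes g b :: "nat \<Rightarrow> real"
  defines "r \<equiv> \<lambda>n. 1 - (\<Sum>i\<le>n. g i)"
  assumes g: "\<And>k. 0 \<le> g k" "g 0 = 0" "0 < g 1" "g sums 1"
    and r: "summable r"
    and rec: "\<And>n. b (Suc n) = (\<Sum>k\<le>Suc n. g k * b (Suc n - k))"
    and B: "\<And>n. \<bar>b n\<bar> \<le> B"
    and \<eta>: "\<eta> > 0"
  shows "eventually (\<lambda>n. b n < b 0 / suminf r + \<eta>) sequentially"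
proof -
  obtain s \<phi> where \<phi>: "strict_mono \<phi>" "(\<lambda>j. b (\<phi> j)) \<longlonglongrightarrow> s"
    and s: "\<forall>\<eta>>0. eventually (\<lambda>n. b n < s + \<eta>) sequentially"
    by (rule bounded_limsup_subseq[of b B, OF B])
  \<comment> \<open>The excess of \<open>b\<close> over its upper limit.\<close>
  define w where "w n = max 0 (b n - s)" for n
  have w: "w \<longlonglongrightarrow> 0"
  proof (rule tendstoI)
    fix e :: real assume "e > 0"
    show "eventually (\<lambda>n. dist (w n) 0 < e) sequentially"
      using s[rule_format, OF \<open>e > 0\<close>] by eventually_elim (use \<open>e > 0\<close> in \<open>auto simp: w_def\<close>)
  qed
  have w_bound: "\<bar>w n\<bar> \<le> B + \<bar>s\<bar>" for n
    using B[of n] by (auto simp: w_def)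
  have shift: "filterlim (\<lambda>n. n - k) sequentially sequentially" for k :: nat
    by (rule filterlim_minus_const_nat_at_top)
  have g_sum: "summable g"
    using g(4) by (rule sums_summable)
  have w_shift: "(\<lambda>n. w (n - k)) \<longlonglongrightarrow> 0" for k
    by (rule filterlim_compose[OF w shift])
  have conv: "(\<lambda>n. \<Sum>k\<le>n. g k * w (n - k)) \<longlonglongrightarrow> 0"
    using convolution_tendsto[of g w _ sequentially "\<lambda>n. n", OF g_sum g(1) w_bound _ filterlim_ident w_shift]
    by simp
  have G: "(\<lambda>n. \<Sum>k\<le>n. g k) \<longlonglongrightarrow> 1"
    using g(4) by (simp add: sums_def_le)
  have step: "(\<lambda>j. b (\<psi> j - 1)) \<longlonglongrightarrow> s"
    if \<psi>: "filterlim \<psi> sequentially sequentially" "(\<lambda>j. b (\<psi> j)) \<longlonglongrightarrow> s" for \<psi> :: "nat \<Rightarrow> nat"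
  proof -
    have upper: "g 1 * (s - b (n - 1)) \<le> s * (\<Sum>k\<le>n. g k) + (\<Sum>k\<le>n. g k * w (n - k)) - b n"
      if "n \<ge> 1" for n
    proof -
      have "g 1 * (s - b (n - 1)) \<le> g 1 * (s + w (n - 1) - b (n - 1))"
        using g(3) by (intro mult_left_mono) (auto simp: w_def)
      also have "\<dots> \<le> (\<Sum>k\<le>n. g k * (s + w (n - k) - b (n - k)))"
        by (rule member_le_sum[where f = "\<lambda>k. g k * (s + w (n - k) - b (n - k))"])
           (use that g(1) in \<open>auto simp: w_def intro!: mult_nonneg_nonneg\<close>)
      also have "\<dots> = s * (\<Sum>k\<le>n. g k) + (\<Sum>k\<le>n. g k * w (n - k)) - (\<Sum>k\<le>n. g k * b (n - k))"
        by (simp add: sum.distrib sum_subtractf algebra_simps sum_distrib_left)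
      also have "(\<Sum>k\<le>n. g k * b (n - k)) = b n"
        using rec[of "n - 1"] that by simp
      finally show ?thesis .
    qed
    have "(\<lambda>j. s - b (\<psi> j - 1)) \<longlonglongrightarrow> 0"
    proof (rule tendsto_sandwich)
      show "eventually (\<lambda>j. - w (\<psi> j - 1) \<le> s - b (\<psi> j - 1)) sequentially"
        by (intro always_eventually) (auto simp: w_def)
      have "eventually (\<lambda>j. \<psi> j \<ge> 1) sequentially"
        using \<psi>(1) by (auto simp: filterlim_at_top)
      thus "eventually (\<lambda>j. s - b (\<psi> j - 1) \<le>
        (s * (\<Sum>k\<le>\<psi> j. g k) + (\<Sum>k\<le>\<psi> j. g k * w (\<psi> j - k)) - b (\<psi> j)) / g 1) sequentially"
        by eventually_elim (use upper g(3) in \<open>simp add: field_simps\<close>)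
      show "(\<lambda>j. - w (\<psi> j - 1)) \<longlonglongrightarrow> 0"
        using tendsto_minus[OF filterlim_compose[OF w filterlim_compose[OF shift[of 1] \<psi>(1)]]] by simp
      have "(\<lambda>j. (s * (\<Sum>k\<le>\<psi> j. g k) + (\<Sum>k\<le>\<psi> j. g k * w (\<psi> j - k)) - b (\<psi> j)) / g 1)
          \<longlonglongrightarrow> (s * 1 + 0 - s) / g 1"
        by (intro tendsto_intros \<psi> filterlim_compose[OF G \<psi>(1)] filterlim_compose[OF conv \<psi>(1)])
           (use g(3) in auto)
      thus "(\<lambda>j. (s * (\<Sum>k\<le>\<psi> j. g k) + (\<Sum>k\<le>\<psi> j. g k * w (\<psi> j - k)) - b (\<psi> j)) / g 1)
          \<longlonglongrightarrow> 0" by simp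
    qed
    from tendsto_diff[OF tendsto_const[of s] this] show ?thesis by simp
  qed
  have \<phi>': "filterlim \<phi> sequentially sequentially"
    using \<phi>(1) by (rule filterlim_subseq)
  have all: "(\<lambda>j. b (\<phi> j - k)) \<longlonglongrightarrow> s" for k
  proof (induction k)
    case 0
    thus ?case using \<phi>(2) by simp
  next
    case (Suc k)
    thus ?case using step[OF filterlim_compose[OF shift[of k] \<phi>']] by simp
  qed
  have r_nonneg: "0 \<le> r n" for n
    using sum_le_suminf[of g "{..n}"] g(1,4) by (auto simp: r_def sums_iff)
  have "(\<lambda>j. \<Sum>k\<le>\<phi> j. r k * b (\<phi> j - k)) \<longlonglongrightarrow> (\<Sum>k. r k * s)"
    by (rule convolution_tendsto[of r b _ sequentially \<phi>, OF r r_nonneg B _ \<phi>' all]) simp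
  hence "(\<Sum>k. r k * s) = b 0"
    using renewal_tail_identity[of g b, OF g(2) rec] LIMSEQ_unique[OF _ tendsto_const]
    by (simp add: r_def)
  hence "suminf r * s = b 0"
    using r by (simp add: suminf_mult2)
  moreover have "suminf r \<ge> r 0"
    using sum_le_suminf[of r "{0}"] r r_nonneg by auto
  hence "suminf r > 0"
    using g(2) by (simp add: r_def)
  ultimately have "s = b 0 / suminf r"
    by (simp add: field_simps)
  thus ?thesis using s \<eta> by simp
qed

text \<open>The renewal theorem of Erdos, Feller and Pollard in the positive recurrent case, where \<open>a\<close> is bounded away
from \<open>0\<close>. The tails \<open>r\<close> of \<open>g\<close> are nonincreasing, and their convolution with \<open>a\<close> is constant. A
negative tail would push this constant to \<open>-\<infinity>\<close>; so the tails are nonnegative, and the lower bound on \<open>a\<close> makes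
them summable. In particular they tend to \<open>0\<close>, that is, \<open>g\<close> sums to \<open>1\<close>. The upper and the lower limit of \<open>a\<close>
are now both equal to \<open>a 0 / suminf r\<close>.\<close>

theorem renewal_theorem:
  fixes a g :: "nat \<Rightarrow> real"
  assumes g: "\<And>k. 0 \<le> g k" "g 0 = 0" "0 < g 1"
    and rec: "\<And>n. a (Suc n) = (\<Sum>k\<le>Suc n. g k * a (Suc n - k))"
    and lower: "0 < c" "\<And>n. c \<le> a n"
    and upper: "\<And>n. a n \<le> C"
  obtains L where "L > 0" "a \<longlonglongrightarrow> L"
proof -
  define r where "r n = 1 - (\<Sum>i\<le>n. g i)" for n
  have E: "(\<Sum>k\<le>n. r k * a (n - k)) = a 0" for n
    unfolding r_def by (rule renewal_tail_identity[of g a, OF g(2) rec])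
  have a_pos: "0 < a n" for n
    using lower(1) lower(2)[of n] by linarith
  have r_le1: "r n \<le> 1" for n
    using g(1) by (simp add: r_def sum_nonneg)
  have r_dec: "r n \<le> r m" if "m \<le> n" for m n
    unfolding r_def using that g(1) by (simp add: sum_mono2)
  have r_nonneg: "0 \<le> r m" for m
  proof (rule ccontr)
    assume neg: "\<not> 0 \<le> r m"
    \<comment> \<open>The first \<open>m\<close> terms of the convolution are at most \<open>C\<close> each, all later ones at most \<open>r m * c < 0\<close>.\<close>
    have bound: "0 \<le> m * C + k * (r m * c)" for k :: nat
    proof -
      have "0 \<le> (\<Sum>i\<le>m+k. r i * a (m + k - i))"
        using E[of "m + k"] a_pos[of 0] by simp
      also have "\<dots> \<le> (\<Sum>i\<le>m+k. (if i < m then C else r m * c))"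
      proof (rule sum_mono)
        fix i
        show "r i * a (m + k - i) \<le> (if i < m then C else r m * c)"
        proof (cases "i < m")
          case True
          have "r i * a (m + k - i) \<le> 1 * a (m + k - i)"
            using r_le1 a_pos by (intro mult_right_mono) (auto intro: less_imp_le)
          thus ?thesis using upper[of "m + k - i"] True by simp
        next
          case False
          have "r i * a (m + k - i) \<le> r m * a (m + k - i)"
            using False r_dec a_pos by (intro mult_right_mono) (auto intro: less_imp_le)
          also have "\<dots> \<le> r m * c"
            using neg lower by (intro mult_left_mono_neg) auto
          finally show ?thesis using False by simp
        qed
      qed
      also have "\<dots> = (\<Sum>i\<in>{..<m}. C) + (\<Sum>i\<in>{m..m+k}. r m * c)"
      proof -
        have "{..m+k} \<inter> {i. i < m} = {..<m}" "{..m+k} \<inter> - {i. i < m} = {m..m+k}" by auto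
        thus ?thesis by (simp add: sum.If_cases)
      qed
      also have "\<dots> = m * C + (k + 1) * (r m * c)" by simp
      also have "\<dots> \<le> m * C + k * (r m * c)"
        using neg lower(1) by (simp add: mult_le_0_iff algebra_simps)
      finally show ?thesis .
    qed
    have "r m * c < 0" using neg lower(1) by (simp add: mult_less_0_iff)
    then obtain k :: nat where "real k * (- (r m * c)) > m * C"
      using reals_Archimedean3[of "- (r m * c)"] by auto
    thus False using bound[of k] by simp
  qed
  have "(\<Sum>k\<le>n. r k) \<le> a 0 / c" for n
  proof -
    have "(\<Sum>k\<le>n. r k) * c = (\<Sum>k\<le>n. r k * c)"
      by (rule sum_distrib_right)
    also have "\<dots> \<le> (\<Sum>k\<le>n. r k * a (n - k))"
      by (intro sum_mono mult_left_mono lower r_nonneg)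
    finally show ?thesis using E[of n] lower(1) by (simp add: field_simps)
  qed
  hence r_sum: "summable r"
    using r_nonneg by (intro bounded_imp_summable)
  have "(\<lambda>n. 1 - r n) \<longlonglongrightarrow> 1 - 0"
    by (intro tendsto_intros summable_LIMSEQ_zero r_sum)
  hence g1: "g sums 1"
    by (simp add: sums_def_le r_def)
  define L where "L = a 0 / suminf r"
  have "suminf r \<ge> r 0"
    using sum_le_suminf[of r "{0}"] r_sum r_nonneg by auto
  hence "suminf r > 0"
    using g(2) by (simp add: r_def)
  hence "L > 0"
    using a_pos by (simp add: L_def)
  have r_eq: "r = (\<lambda>n. 1 - (\<Sum>i\<le>n. g i))" by (simp add: fun_eq_iff r_def)
  have bounded: "\<bar>a n\<bar> \<le> C" "\<bar>- a n\<bar> \<le> C" for n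
    using a_pos[of n] upper[of n] by auto
  have rec': "- a (Suc n) = (\<Sum>k\<le>Suc n. g k * - a (Suc n - k))" for n
    using rec[of n] by (simp add: sum_negf)
  have "a \<longlonglongrightarrow> L"
  proof (rule tendstoI)
    fix e :: real assume e: "e > 0"
    have "eventually (\<lambda>n. a n < L + e) sequentially"
      using renewal_limsup_le[of g a, OF g g1 _ rec bounded(1) e] r_sum
      by (simp add: L_def flip: r_eq)
    moreover have "eventually (\<lambda>n. - a n < - L + e) sequentially"
      using renewal_limsup_le[of g "\<lambda>n. - a n", OF g g1 _ rec' bounded(2) e] r_sum
      by (simp add: L_def flip: r_eq)
    ultimately show "eventually (\<lambda>n. dist (a n) L < e) sequentially"
      by eventually_elim (auto simp: dist_real_def)
  qed
  thus ?thesis using that \<open>L > 0\<close> by blast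
qed

section \<open>Growth of the number of closed paths\<close>

text \<open>The rate is the supremum of \<open>root m (s m)\<close>. Comparing \<open>s (m * n)\<close> with \<open>s m ^ n\<close> from below and with
\<open>(K * s n) ^ m\<close> from above shows that every \<open>root m (s m)\<close> is at most every \<open>root n (K * s n)\<close>.\<close>

lemma geometric_growth_rate:
  fixes s :: "nat \<Rightarrow> real"
  assumes pos: "\<And>n. 1 \<le> s n"
    and super: "\<And>m n. s m * s n \<le> s (m + n)"
    and sub: "\<And>m n. s (m + n) \<le> K * s m * s n"
  obtains \<Lambda> where "\<Lambda> > 0" "\<And>n. s n \<le> \<Lambda> ^ n" "\<And>n. \<Lambda> ^ n \<le> K * s n"
proof -
  have spos: "0 < s n" for n using pos[of n] by linarith
  have "s 0 * s 0 \<le> s 0 * 1" using super[of 0 0] by simp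
  hence s0: "s 0 = 1" using pos[of 0] spos[of 0] by (simp add: mult_le_cancel_left)
  have K: "1 \<le> K" using sub[of 0 0] s0 by simp
  have up: "s n ^ m \<le> s (m * n)" for m n
  proof (induction m)
    case (Suc m)
    have "s n ^ Suc m \<le> s n * s (m * n)"
      using Suc spos[of n] by (simp add: mult_left_mono)
    also have "\<dots> \<le> s (Suc m * n)" using super[of n "m * n"] by simp
    finally show ?case .
  qed (simp add: s0)
  have down: "s (m * n) \<le> (K * s n) ^ m" for m n
  proof (induction m)
    case (Suc m)
    have "s (Suc m * n) \<le> K * s n * s (m * n)" using sub[of n "m * n"] by simp
    also have "\<dots> \<le> K * s n * (K * s n) ^ m"
      using Suc K spos[of n] by (intro mult_left_mono) auto
    finally show ?case by simp
  qed (simp add: s0)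
  have cross: "root m (s m) \<le> root n (K * s n)" if "m \<ge> 1" "n \<ge> 1" for m n
  proof -
    define y t where "y = root m (s m)" and "t = root n (K * s n)"
    have y: "y ^ m = s m" "0 < y" and t: "t ^ n = K * s n" "0 < t"
      using that spos[of m] spos[of n] K
      by (auto simp: y_def t_def real_root_pow_pos real_root_gt_zero)
    have "y ^ (m * n) = s m ^ n" by (simp add: power_mult y)
    also have "\<dots> \<le> s (n * m)" by (rule up)
    also have "\<dots> \<le> (K * s n) ^ m" using down[of m n] by (simp add: mult.commute)
    also have "\<dots> = t ^ (m * n)" by (metis power_mult t(1) mult.commute)
    finally show ?thesis
      using that y t power_mono_iff[of y t "m * n"] by (simp add: y_def t_def)
  qed
  define \<Lambda> where "\<Lambda> = (SUP m\<in>{1..}. root m (s m))"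
  have bdd: "bdd_above ((\<lambda>m. root m (s m)) ` {1..})"
    using cross[of _ 1] by (intro bdd_aboveI2[where M = "root 1 (K * s 1)"]) auto
  have lo: "root m (s m) \<le> \<Lambda>" if "m \<ge> 1" for m
    unfolding \<Lambda>_def using bdd that by (intro cSUP_upper) auto
  have hi: "\<Lambda> \<le> root n (K * s n)" if "n \<ge> 1" for n
    unfolding \<Lambda>_def using that cross by (intro cSUP_least) auto
  have pos\<Lambda>: "\<Lambda> > 0" using lo[of 1] spos[of 1] by simp
  show ?thesis
  proof
    show "\<Lambda> > 0" by (rule pos\<Lambda>)
    fix n
    show "s n \<le> \<Lambda> ^ n"
    proof (cases "n = 0")
      case False
      have "s n = root n (s n) ^ n" using False spos[of n] by (simp add: real_root_pow_pos)
      also have "\<dots> \<le> \<Lambda> ^ n"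
        using lo[of n] False spos[of n] by (intro power_mono) (auto intro: less_imp_le)
      finally show ?thesis .
    qed (simp add: s0)
    show "\<Lambda> ^ n \<le> K * s n"
    proof (cases "n = 0")
      case False
      have "\<Lambda> ^ n \<le> root n (K * s n) ^ n"
        using hi[of n] False pos\<Lambda> by (intro power_mono) auto
      also have "\<dots> = K * s n" using False spos[of n] K by (simp add: real_root_pow_pos)
      finally show ?thesis .
    qed (simp add: s0 K)
  qed
qed

lemma N_pos_imp_sign_poly:
  assumes "\<beta> \<noteq> 0" "N \<beta> n x > 0"
  shows "\<exists>F. sign_poly n F \<and> rat_eval F \<beta> = x"
  using assms(2)
proof (induction n arbitrary: x)
  case 0
  hence "x = 0" by (simp add: N_0_eq split: if_splits)
  thus ?case by (intro exI[of _ 0]) (simp add: sign_poly_def)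
next
  case (Suc n)
  have "2 * real (N \<beta> n (x / \<beta>)) + real (N \<beta> n ((x - 1) / \<beta>)) + real (N \<beta> n ((x + 1) / \<beta>)) > 0"
    using Suc.prems unfolding N_Suc_eq[OF assms(1), symmetric] by simp
  hence "N \<beta> n (x / \<beta>) > 0 \<or> N \<beta> n ((x - 1) / \<beta>) > 0 \<or> N \<beta> n ((x + 1) / \<beta>) > 0"
    by linarith
  hence "\<exists>e\<in>{0, 1, -1 :: rat}. N \<beta> n ((x - of_rat e) / \<beta>) > 0" by auto
  then obtain e :: rat where e: "e \<in> {0, 1, -1}" "N \<beta> n ((x - of_rat e) / \<beta>) > 0" by blast
  then obtain F where F: "sign_poly n F" "rat_eval F \<beta> = (x - of_rat e) / \<beta>"
    using Suc.IH by blast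
  have "sign_poly (Suc n) (pCons e F)"
    using F(1) e(1) by (auto simp: sign_poly_def coeff_pCons split: nat.splits)
  moreover have "rat_eval (pCons e F) \<beta> = x"
    using F(2) assms(1) by simp
  ultimately show ?case by blast
qed

text \<open>In the sum over the position \<open>x\<close> after \<open>m\<close> steps of a closed path of length \<open>m + n\<close>, only the finitely many recurrent points
contribute, and each term is at most the term at \<open>x = 0\<close> by the autocorrelation bound. The constant is the
number of recurrent points.\<close>

lemma N_submultiplicative:
  assumes "hyperbolic \<beta>"
  shows "\<exists>K::real. \<forall>m n. real (N \<beta> (m + n) 0) \<le> K * real (N \<beta> m 0) * real (N \<beta> n 0)"
proof -
  have \<beta>: "\<beta> \<noteq> 0" using assms by (auto simp: hyperbolic_def)
  define V where "V = {rat_eval F \<beta> | F. \<exists>n m G. sign_poly n F \<and> sign_poly m G \<and> \<beta> ^ m * rat_eval F \<beta> + rat_eval G \<beta> = 0}"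
  have V: "finite V" unfolding V_def by (rule hyperbolic_finite_recurrent[OF assms])
  have "real (N \<beta> (m + n) 0) \<le> real (card V) * real (N \<beta> m 0) * real (N \<beta> n 0)" for m n
  proof -
    have in_V: "x \<in> V" if pos: "N \<beta> m x > 0" "N \<beta> n (0 - \<beta> ^ n * x) > 0" for x
    proof -
      obtain F where "sign_poly m F" "rat_eval F \<beta> = x"
        using N_pos_imp_sign_poly[OF \<beta> pos(1)] by blast
      moreover obtain G where "sign_poly n G" "rat_eval G \<beta> = 0 - \<beta> ^ n * x"
        using N_pos_imp_sign_poly[OF \<beta> pos(2)] by blast
      ultimately have "sign_poly m F \<and> sign_poly n G \<and> \<beta> ^ n * rat_eval F \<beta> + rat_eval G \<beta> = 0" by simp
      thus "x \<in> V" unfolding V_def using \<open>rat_eval F \<beta> = x\<close> by blast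
    qed
    have "real (N \<beta> (m + n) 0)
        = (\<Sum>x | N \<beta> m x > 0. real (N \<beta> m x) * N \<beta> n (0 - \<beta> ^ n * x))"
      by (rule N_add[OF \<beta>])
    also have "\<dots> = (\<Sum>x\<in>{x. N \<beta> m x > 0} \<inter> V. real (N \<beta> m x) * N \<beta> n (0 - \<beta> ^ n * x))"
      using in_V by (intro sum.mono_neutral_right finite_N_support[OF \<beta>]) auto
    also have "\<dots> \<le> (\<Sum>x\<in>{x. N \<beta> m x > 0} \<inter> V. real (N \<beta> m 0) * N \<beta> n 0)"
      by (intro sum_mono mult_mono) (auto simp: N_le_N_0)
    also have "\<dots> = card ({x. N \<beta> m x > 0} \<inter> V) * (real (N \<beta> m 0) * N \<beta> n 0)"
      by simp
    also have "\<dots> \<le> card V * (real (N \<beta> m 0) * N \<beta> n 0)"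
      using V by (intro mult_right_mono) (auto intro!: card_mono)
    finally show ?thesis by (simp add: mult_ac)
  qed
  thus ?thesis by blast
qed

lemma N_0_pos: "\<beta> \<noteq> 0 \<Longrightarrow> N \<beta> n 0 > 0"
proof (induction n)
  case (Suc n)
  have "real (N \<beta> (Suc n) 0) > 0"
    using Suc by (subst N_Suc_eq) auto
  thus ?case by simp
qed (simp add: N_0_eq)

lemma N_add_ge:
  assumes "\<beta> \<noteq> 0"
  shows "N \<beta> m 0 * N \<beta> n y \<le> N \<beta> (m + n) y"
proof -
  have "real (N \<beta> m 0) * N \<beta> n (y - \<beta> ^ n * 0) \<le> real (N \<beta> (m + n) y)"
    unfolding N_add[OF assms]
    by (rule member_le_sum[where f = "\<lambda>x. real (N \<beta> m x) * N \<beta> n (y - \<beta> ^ n * x)"])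
       (auto simp: N_0_pos[OF assms] finite_N_support[OF assms])
  thus ?thesis by (simp flip: of_nat_mult)
qed

section \<open>First return and last visit\<close>

text \<open>The weighted number of \<open>n\<close>-step paths from \<open>0\<close> to \<open>x\<close> that do not visit \<open>0\<close> after time \<open>0\<close>.\<close>

primrec avoiding :: "real \<Rightarrow> nat \<Rightarrow> real \<Rightarrow> real" where
  "avoiding \<beta> 0 = (\<lambda>x. of_bool (x = 0))"
| "avoiding \<beta> (Suc n) = (\<lambda>x. if x = 0 then 0 else
      2 * avoiding \<beta> n (x / \<beta>) + avoiding \<beta> n ((x - 1) / \<beta>) + avoiding \<beta> n ((x + 1) / \<beta>))"

text \<open>The weighted number of paths from \<open>0\<close> that return to \<open>0\<close> at time \<open>n\<close> for the first time.\<close>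

primrec first_return :: "real \<Rightarrow> nat \<Rightarrow> real" where
  "first_return \<beta> 0 = 0"
| "first_return \<beta> (Suc n) = 2 * avoiding \<beta> n 0 + avoiding \<beta> n (- 1 / \<beta>) + avoiding \<beta> n (1 / \<beta>)"

lemma avoiding_nonneg: "avoiding \<beta> n x \<ge> 0"
  by (induction n arbitrary: x) auto

lemma first_return_nonneg: "first_return \<beta> n \<ge> 0"
  by (cases n) (auto simp: avoiding_nonneg)

text \<open>A path from \<open>0\<close> to \<open>x\<close> is cut at its last visit to \<open>0\<close>; the part after that visit has length \<open>k\<close>.\<close>

lemma last_visit_decomposition:
  assumes "\<beta> \<noteq> 0"
  shows "real (N \<beta> n x) = (\<Sum>k\<le>n. avoiding \<beta> k x * N \<beta> (n - k) 0)"
proof (induction n arbitrary: x)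
  case 0
  show ?case by (simp add: N_0_eq)
next
  case (Suc n)
  show ?case
  proof (cases "x = 0")
    case True
    thus ?thesis by (subst sum.atMost_Suc_shift) simp
  next
    case False
    have "(\<Sum>k\<le>Suc n. avoiding \<beta> k x * N \<beta> (Suc n - k) 0)
        = (\<Sum>k\<le>n. avoiding \<beta> (Suc k) x * N \<beta> (n - k) 0)"
      using False by (subst sum.atMost_Suc_shift) simp
    also have "\<dots> = real (N \<beta> (Suc n) x)"
      using False by (simp add: N_Suc_eq[OF assms] Suc sum_distrib_left sum.distrib algebra_simps)
    finally show ?thesis by simp
  qed
qed

text \<open>The renewal equation for the closed paths. It follows from the preceding decomposition of the paths to the
three predecessors of \<open>0\<close>.\<close>

lemma first_return_decomposition:
  assumes "\<beta> \<noteq> 0"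
  shows "real (N \<beta> (Suc n) 0) = (\<Sum>k\<le>Suc n. first_return \<beta> k * N \<beta> (Suc n - k) 0)"
proof -
  have "real (N \<beta> (Suc n) 0) = 2 * real (N \<beta> n 0) + real (N \<beta> n (- 1 / \<beta>)) + real (N \<beta> n (1 / \<beta>))"
    using N_Suc_eq[OF assms, of n 0] by simp
  also have "\<dots> = (\<Sum>k\<le>n. first_return \<beta> (Suc k) * N \<beta> (n - k) 0)"
    by (simp only: last_visit_decomposition[OF assms, of n "- 1 / \<beta>"]
          last_visit_decomposition[OF assms, of n "1 / \<beta>"] last_visit_decomposition[OF assms, of n 0])
       (simp add: sum_distrib_left sum.distrib algebra_simps)
  also have "\<dots> = (\<Sum>k\<le>Suc n. first_return \<beta> k * N \<beta> (Suc n - k) 0)"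
    using sum.atMost_Suc_shift[of "\<lambda>k. first_return \<beta> k * real (N \<beta> (Suc n - k) 0)" n] by simp
  finally show ?thesis .
qed

section \<open>Eigenfunctions of infinite mass\<close>

text \<open>Suppose the total mass \<open>S\<close> is finite. Summing the eigenvalue equation over all \<open>y\<close> gives
\<open>\<Lambda> * S = 4 * S\<close>, as each shifted copy of \<open>\<mu>\<close> has the same mass, so \<open>\<Lambda> = 4\<close>. Then \<open>\<mu> y\<close> is a weighted average
of its values at the predecessors of \<open>y\<close>, and by the maximum principle the maximal value \<open>\<mu> 0\<close> is inherited by
the predecessors. Starting with the predecessor \<open>1 / \<beta>\<close> of \<open>0\<close>, the points \<open>1 / \<beta> ^ k\<close>
all carry the mass \<open>\<mu> 0 > 0\<close>, contradicting finiteness.\<close>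

lemma eigenfunction_infinite_mass:
  fixes \<mu> :: "real \<Rightarrow> real"
  assumes \<beta>: "\<beta> > 1" and \<Lambda>: "\<Lambda> > 0"
    and nonneg: "\<And>x. 0 \<le> \<mu> x"
    and eigen: "\<And>y. \<Lambda> * \<mu> y = 2 * \<mu> (y / \<beta>) + \<mu> ((y - 1) / \<beta>) + \<mu> ((y + 1) / \<beta>)"
    and max0: "\<And>x. \<mu> x \<le> \<mu> 0" and pos: "0 < \<mu> 0"
  shows "(\<integral>\<^sup>+x. ennreal (\<mu> x) \<partial>count_space UNIV) = \<infinity>"
proof (rule ccontr)
  define S where "S = (\<integral>\<^sup>+x. ennreal (\<mu> x) \<partial>count_space UNIV)"
  assume "\<not> ?thesis"
  hence fin: "S \<noteq> \<infinity>" by (simp add: S_def)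
  have lower: "ennreal (\<mu> 0) * emeasure (count_space UNIV) A \<le> S" if "\<And>x. x \<in> A \<Longrightarrow> \<mu> x = \<mu> 0" for A
  proof -
    have "ennreal (\<mu> 0) * emeasure (count_space UNIV) A
        = (\<integral>\<^sup>+x. ennreal (\<mu> 0) * indicator A x \<partial>count_space UNIV)"
      by (rule nn_integral_cmult_indicator[symmetric]) simp
    also have "\<dots> \<le> S"
      unfolding S_def using that by (intro nn_integral_mono) (auto simp: indicator_def)
    finally show ?thesis .
  qed
  have shift: "(\<integral>\<^sup>+y. ennreal (\<mu> ((y + e) / \<beta>)) \<partial>count_space UNIV) = S" for e
    unfolding S_def
  proof (rule nn_integral_bij_count_space)
    show "bij_betw (\<lambda>y. (y + e) / \<beta>) UNIV UNIV"
      using \<beta> by (intro bij_betwI[where g = "\<lambda>x. \<beta> * x - e"]) auto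
  qed
  have "ennreal \<Lambda> * S = (\<integral>\<^sup>+y. ennreal (\<Lambda> * \<mu> y) \<partial>count_space UNIV)"
    unfolding S_def using \<Lambda> by (simp add: ennreal_mult' nn_integral_cmult)
  also have "\<dots> = (\<integral>\<^sup>+y. 2 * ennreal (\<mu> ((y + 0) / \<beta>)) + ennreal (\<mu> ((y + -1) / \<beta>))
      + ennreal (\<mu> ((y + 1) / \<beta>)) \<partial>count_space UNIV)"
    by (intro nn_integral_cong) (simp add: eigen nonneg ennreal_mult')
  also have "\<dots> = 2 * S + S + S"
    by (simp only: nn_integral_add nn_integral_cmult borel_measurable_count_space shift)
  also have "\<dots> = (2 + 1 + 1) * S"
    by (simp only: distrib_right mult_1_left)
  also have "2 + 1 + 1 = ennreal 4" by simp
  finally have "ennreal \<Lambda> * S = ennreal 4 * S" .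
  moreover have "S \<noteq> 0"
    using lower[of "{0}"] pos by auto
  moreover obtain s where "S = ennreal s" "s \<ge> 0"
    using fin by (cases S) auto
  ultimately have "\<Lambda> = 4"
    using \<Lambda> by (simp flip: ennreal_mult' ennreal_numeral)
  have one: "\<mu> (1 / \<beta>) = \<mu> 0"
    using eigen[of 0] max0[of "1 / \<beta>"] max0[of "- 1 / \<beta>"] \<open>\<Lambda> = 4\<close> by simp
  have step: "\<mu> (y / \<beta>) = \<mu> 0" if "\<mu> y = \<mu> 0" for y
    using eigen[of y] max0[of "y / \<beta>"] max0[of "(y - 1) / \<beta>"] max0[of "(y + 1) / \<beta>"] \<open>\<Lambda> = 4\<close> that
    by simp
  have "\<mu> (1 / \<beta> ^ Suc k) = \<mu> 0" for k
  proof (induction k)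
    case (Suc k)
    from step[OF this] show ?case by (simp add: mult.commute)
  qed (use one in simp)
  moreover have "infinite (range (\<lambda>k. 1 / \<beta> ^ Suc k))"
  proof (rule range_inj_infinite)
    show "inj (\<lambda>k. 1 / \<beta> ^ Suc k)" using \<beta> by (auto intro!: injI simp: power_inject_exp simp del: power_Suc)
  qed
  ultimately have "ennreal (\<mu> 0) * \<infinity> \<le> S"
    using lower[of "range (\<lambda>k. 1 / \<beta> ^ Suc k)"] by auto
  thus False using fin pos by (simp add: ennreal_mult_top top_unique)
qed

section \<open>Existence of the limit measure\<close>

theorem theorem1p1:
  fixes \<beta> :: real
  assumes "hyperbolic \<beta>"
  shows "\<exists>\<Lambda>::real. \<Lambda> > 1 \<and>
    (\<exists>\<mu> :: real \<Rightarrow> real.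
      (\<forall>x \<in> X \<beta>. (\<lambda>n. 1 / \<Lambda> ^ n * real (N \<beta> n x)) \<longlonglongrightarrow> \<mu> x \<and> \<mu> x > 0) \<and>
      emeasure (point_measure (X \<beta>) (\<lambda>x. ennreal (\<mu> x))) (X \<beta>) = \<infinity>)"
proof -
  have \<beta>1: "\<beta> > 1" and \<beta>: "\<beta> \<noteq> 0" using assms by (auto simp: hyperbolic_def)
  have N1: "1 \<le> real (N \<beta> n 0)" for n using N_0_pos[OF \<beta>, of n] by linarith
  have super: "real (N \<beta> m 0) * real (N \<beta> n 0) \<le> real (N \<beta> (m + n) 0)" for m n
    using N_add_ge[OF \<beta>, of m n 0] by (simp flip: of_nat_mult)
  obtain K :: real where K: "\<And>m n. real (N \<beta> (m + n) 0) \<le> K * real (N \<beta> m 0) * real (N \<beta> n 0)"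
    using N_submultiplicative[OF assms] by blast
  obtain \<Lambda> where \<Lambda>0: "\<Lambda> > 0" and up: "\<And>n. real (N \<beta> n 0) \<le> \<Lambda> ^ n" and low: "\<And>n. \<Lambda> ^ n \<le> K * real (N \<beta> n 0)"
    using geometric_growth_rate[of "\<lambda>n. real (N \<beta> n 0)" K, OF N1 super K] by blast
  have "real (N \<beta> 1 0) \<ge> 2" using N_Suc_eq[OF \<beta>, of 0 0] by (simp add: N_0_eq)
  hence \<Lambda>1: "\<Lambda> > 1" using up[of 1] by simp
  have K1: "K \<ge> 1" using low[of 0] by (simp add: N_0_eq)
  define a where "a n = real (N \<beta> n 0) / \<Lambda> ^ n" for n
  define g where "g k = first_return \<beta> k / \<Lambda> ^ k" for k
  have a_le: "a n \<le> 1" and a_ge: "1 / K \<le> a n" for n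
    using up[of n] low[of n] \<Lambda>0 K1 by (auto simp: a_def field_simps)
  have scale: "x * y / \<Lambda> ^ n = x / \<Lambda> ^ k * (y / \<Lambda> ^ (n - k))" if "k \<le> n" for x y k n
    using that by (simp flip: power_add)
  have rec: "a (Suc n) = (\<Sum>k\<le>Suc n. g k * a (Suc n - k))" for n
    unfolding a_def g_def first_return_decomposition[OF \<beta>] sum_divide_distrib
    by (intro sum.cong refl scale) auto
  have g: "0 \<le> g k" "g 0 = 0" "0 < g 1" for k
    using first_return_nonneg[of \<beta> k] avoiding_nonneg[of \<beta> 0 "1 / \<beta>"] \<Lambda>0 by (auto simp: g_def)
  obtain L where L: "L > 0" "a \<longlonglongrightarrow> L"
    using renewal_theorem[of g a "1 / K" 1, OF g rec _ a_ge a_le] K1 by auto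
  define h where "h x k = avoiding \<beta> k x / \<Lambda> ^ k" for x k
  have h_nonneg: "0 \<le> h x k" for x k
    using avoiding_nonneg \<Lambda>0 by (simp add: h_def)
  have conv: "1 / \<Lambda> ^ n * N \<beta> n x = (\<Sum>k\<le>n. h x k * a (n - k))" for n x
  proof -
    have "1 / \<Lambda> ^ n * N \<beta> n x = (\<Sum>k\<le>n. avoiding \<beta> k x * real (N \<beta> (n - k) 0)) / \<Lambda> ^ n"
      by (simp add: last_visit_decomposition[OF \<beta>, of n x])
    also have "\<dots> = (\<Sum>k\<le>n. h x k * a (n - k))"
      unfolding sum_divide_distrib h_def a_def by (intro sum.cong refl scale) auto
    finally show ?thesis .
  qed
  have le_a: "1 / \<Lambda> ^ n * N \<beta> n x \<le> a n" for n x
    using \<Lambda>0 N_le_N_0[of \<beta> n x] by (simp add: a_def divide_right_mono)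
  \<comment> \<open>If the paths that never come back to \<open>0\<close> were too numerous, preceding them by closed paths would give
    more than \<open>N \<beta> n 0\<close> paths to \<open>x\<close>.\<close>
  have h_sum: "summable (h x)" for x
  proof (rule bounded_imp_summable[OF h_nonneg])
    fix n
    have "(\<Sum>k\<le>n. h x k) * (1 / K) = (\<Sum>k\<le>n. h x k * (1 / K))" by (rule sum_distrib_right)
    also have "\<dots> \<le> (\<Sum>k\<le>n. h x k * a (n - k))"
      by (intro sum_mono mult_left_mono a_ge h_nonneg)
    also have "\<dots> \<le> 1" using le_a[of n x] a_le[of n] by (simp only: conv)
    finally show "(\<Sum>k\<le>n. h x k) \<le> K" using K1 by (simp add: field_simps)
  qed
  define \<mu> where "\<mu> x = (\<Sum>k. h x k * L)" for x
  have a_bound: "\<bar>a n\<bar> \<le> 1" for n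
    using a_le[of n] a_ge[of n] K1 by (simp add: abs_le_iff) (smt (verit) divide_nonneg_nonneg)
  have a_shift: "(\<lambda>n. a (n - k)) \<longlonglongrightarrow> L" for k
    by (rule filterlim_compose[OF L(2) filterlim_minus_const_nat_at_top])
  have lim: "(\<lambda>n. 1 / \<Lambda> ^ n * N \<beta> n x) \<longlonglongrightarrow> \<mu> x" for x
    unfolding conv \<mu>_def
    using convolution_tendsto[of "h x" a 1 sequentially "\<lambda>n. n" "\<lambda>_. L",
        OF h_sum h_nonneg a_bound _ filterlim_ident a_shift] by simp
  have \<mu>0: "\<mu> 0 = L"
  proof (rule LIMSEQ_unique[OF _ L(2)])
    show "a \<longlonglongrightarrow> \<mu> 0" using lim[of 0] unfolding a_def by simp
  qed
  have \<mu>_nonneg: "0 \<le> \<mu> x" for x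
    using lim[of x] \<Lambda>0 by (intro LIMSEQ_le_const[OF lim]) auto
  have \<mu>_max: "\<mu> x \<le> \<mu> 0" for x
    unfolding \<mu>0 using le_a by (intro LIMSEQ_le[OF lim L(2)]) auto
  \<comment> \<open>A closed path followed by one fixed path from \<open>0\<close> to \<open>x\<close> is a path to \<open>x\<close>.\<close>
  have \<mu>_pos: "\<mu> x > 0" if xX: "x \<in> X \<beta>" for x
  proof -
    obtain k where k: "N \<beta> k x > 0" using xX[unfolded X_iff] by blast
    have "N \<beta> k x / \<Lambda> ^ k * a n \<le> 1 / \<Lambda> ^ (n + k) * N \<beta> (n + k) x" for n
    proof -
      have "real (N \<beta> n 0) * N \<beta> k x \<le> N \<beta> (n + k) x"
        using N_add_ge[OF \<beta>, of n k x] by (simp flip: of_nat_mult)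
      thus ?thesis using \<Lambda>0 by (simp add: a_def field_simps power_add)
    qed
    hence "N \<beta> k x / \<Lambda> ^ k * L \<le> \<mu> x"
      by (intro LIMSEQ_le[OF tendsto_mult_left[OF L(2)] LIMSEQ_ignore_initial_segment[OF lim]]) auto
    moreover have "N \<beta> k x / \<Lambda> ^ k * L > 0" using k L(1) \<Lambda>0 by simp
    ultimately show ?thesis by linarith
  qed
  have \<mu>_out: "\<mu> x = 0" if "x \<notin> X \<beta>" for x
  proof -
    have "N \<beta> n x = 0" for n using that by (simp add: X_iff)
    thus ?thesis using lim[of x] by (simp add: LIMSEQ_const_iff)
  qed
  \<comment> \<open>The recursion for \<open>N\<close> in the limit.\<close>
  have eigen: "\<Lambda> * \<mu> y = 2 * \<mu> (y / \<beta>) + \<mu> ((y - 1) / \<beta>) + \<mu> ((y + 1) / \<beta>)" for y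
  proof (rule LIMSEQ_unique)
    show "(\<lambda>n. \<Lambda> * (1 / \<Lambda> ^ Suc n * N \<beta> (Suc n) y)) \<longlonglongrightarrow> \<Lambda> * \<mu> y"
      by (intro tendsto_mult_left LIMSEQ_Suc lim)
    have "(\<lambda>n. 2 * (1 / \<Lambda> ^ n * N \<beta> n (y / \<beta>)) + 1 / \<Lambda> ^ n * N \<beta> n ((y - 1) / \<beta>)
          + 1 / \<Lambda> ^ n * N \<beta> n ((y + 1) / \<beta>))
        \<longlonglongrightarrow> 2 * \<mu> (y / \<beta>) + \<mu> ((y - 1) / \<beta>) + \<mu> ((y + 1) / \<beta>)"
      by (intro tendsto_add tendsto_mult_left lim)
    moreover have "\<Lambda> * (1 / \<Lambda> ^ Suc n * N \<beta> (Suc n) y) =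
        2 * (1 / \<Lambda> ^ n * N \<beta> n (y / \<beta>)) + 1 / \<Lambda> ^ n * N \<beta> n ((y - 1) / \<beta>)
          + 1 / \<Lambda> ^ n * N \<beta> n ((y + 1) / \<beta>)" for n
    proof -
      have "\<Lambda> * (1 / \<Lambda> ^ Suc n * t) = t / \<Lambda> ^ n" for t
        using \<Lambda>0 by simp
      thus ?thesis by (simp only: N_Suc_eq[OF \<beta>]) (simp add: add_divide_distrib)
    qed
    ultimately show "(\<lambda>n. \<Lambda> * (1 / \<Lambda> ^ Suc n * N \<beta> (Suc n) y))
        \<longlonglongrightarrow> 2 * \<mu> (y / \<beta>) + \<mu> ((y - 1) / \<beta>) + \<mu> ((y + 1) / \<beta>)" by (simp only:)
  qed
  have "emeasure (point_measure (X \<beta>) (\<lambda>x. ennreal (\<mu> x))) (X \<beta>)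
      = (\<integral>\<^sup>+x. ennreal (\<mu> x) \<partial>count_space (X \<beta>))"
    by (simp add: point_measure_def emeasure_density)
       (intro nn_integral_cong, simp add: indicator_def)
  also have "\<dots> = (\<integral>\<^sup>+x. ennreal (\<mu> x) * indicator (X \<beta>) x \<partial>count_space UNIV)"
    by (rule nn_integral_count_space_indicator) simp
  also have "\<dots> = (\<integral>\<^sup>+x. ennreal (\<mu> x) \<partial>count_space UNIV)"
    using \<mu>_out by (intro nn_integral_cong) (auto simp: indicator_def)
  also have "\<dots> = \<infinity>"
    using eigenfunction_infinite_mass[OF \<beta>1 \<Lambda>0 \<mu>_nonneg eigen \<mu>_max] \<mu>0 L(1) by simp
  finally show ?thesis using \<Lambda>1 lim \<mu>_pos by blast
qed

end
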